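(* Let $D_\lambda$ be a sectorial diagonal operator in $\ell^2(J)$ with angle $\theta\in(0,\pi/2)$ and vertex $0$. Let $f:J\to\mathbb C$ and $g:J\to\mathbb C$ be such that for some $z_0\in(-\infty,0)$, $$\sum_{j\in J}\frac{|g(j)|^2}{|\sqrt{\lambda_j}-z_0|^2}<\infty,\qquad\sum_{j\in J}\frac{|f(j)|^2}{|\sqrt{\lambda_j}-z_0|^2}<\infty,$$ where the square-root is obtained by the branch cut at the non-positive real axis. Let $R_\lambda$ be the square root of $D_\lambda$ and let $$Q_R(h,k)=\langle R_\lambda h,R_\lambda^*k\rangle,\quad h,k\in\mathscr D(R_\lambda),\qquad Q_{f,g}(h,k)=\sum_{j\in J}h(j)\overline{g(j)}\ \sum_{j\in J}f(j)\overline{k(j)}.$$ Then $Q_{f,g}(h,k)$ is defined for all $h,k\in\mathscr D(R_\lambda)$. Moreover, the form $Q_R+Q_{f,g}$ is sectorial and there exists a unique sectorial operator $T$ in $\ell^2(J)$ with domain contained in the domain of $Q_R$ such that $$Q_R(h,k)+Q_{f,g}(h,k)=\langle Th,k\rangle,\quad h\in\mathscr D(T),\ k\in\mathscr D(Q_R).$$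
   Context: $J$ is a countably infinite directed set. $D_\lambda$ is the (maximally defined) diagonal operator in $\ell^2(J)$ with diagonal entries $\{\lambda_j:j\in J\}\subseteq\mathbb C$, $D_\lambda e_j=\lambda_je_j$ for the standard orthonormal basis $\{e_j\}$. A densely defined operator $T$ is sectorial with angle $\theta\in(0,\pi/2)$ and vertex $a\in\mathbb R$ if for some $M\in(0,\infty)$, $\mu\in\rho(T)$ and $\|(T-\mu)^{-1}\|\le\frac{M}{|\mu-a|}$ whenever $\mu\in\mathbb C$ and $|\arg(\mu-a)|\ge\theta$ (this corresponds to Kato's "m-sectorial"). $R_\lambda$ is the unique (sectorial) square root of $D_\lambda$ given by Kato's theorem, i.e. the diagonal operator with entries $\sqrt{\lambda_j}$; $\mathscr D(R_\lambda)=\mathscr D(R_\lambda^* )$. The domain of $Q_R$ is $\mathscr D(Q_R)=\mathscr D(R_\lambda)$. Terminology for sesquilinear forms is as in Kato's Perturbation Theory, Chapter VI: a form $Q$ is sectorial if $\{Q(h,h):\|h\|=1\}$ lies in a sector $\{z:|\arg(z-\gamma)|\le\theta'\}$ with $\gamma\in\mathbb R$, $0\le\theta'<\pi/2$. *)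

theory Defs
  imports "HOL-Analysis.Analysis"
begin

section \<open>The Hilbert space of square-summable families\<close>

text \<open>The index set is the universe of the type \<open>'j\<close>. Sums over it are unordered
  (\<^const>\<open>infsum\<close>); convergence of such a sum of complex numbers is absolute convergence.\<close>

definition ell2 :: "('j \<Rightarrow> complex) set" where
  "ell2 = {h. (\<lambda>j. (cmod (h j))\<^sup>2) summable_on UNIV}"

text \<open>Linear in the first argument.\<close>

definition ell2_inner :: "('j \<Rightarrow> complex) \<Rightarrow> ('j \<Rightarrow> complex) \<Rightarrow> complex" where
  "ell2_inner h k = (\<Sum>\<^sub>\<infinity>j. h j * cnj (k j))"

definition ell2_norm :: "('j \<Rightarrow> complex) \<Rightarrow> real" where
  "ell2_norm h = sqrt (\<Sum>\<^sub>\<infinity>j. (cmod (h j))\<^sup>2)"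

definition linear_submanifold :: "('j \<Rightarrow> complex) set \<Rightarrow> bool" where
  "linear_submanifold D \<longleftrightarrow>
     D \<subseteq> ell2 \<and> (\<lambda>_. 0) \<in> D \<and>
     (\<forall>h\<in>D. \<forall>k\<in>D. (\<lambda>j. h j + k j) \<in> D) \<and>
     (\<forall>c. \<forall>h\<in>D. (\<lambda>j. c * h j) \<in> D)"


section \<open>Unbounded operators\<close>

text \<open>An operator is identified with its graph, so that equality of operators includes equality
  of their domains, and the domain is \<^const>\<open>Domain\<close>.\<close>

type_synonym 'j operator = "(('j \<Rightarrow> complex) \<times> ('j \<Rightarrow> complex)) set"

definition linear_operator :: "'j operator \<Rightarrow> bool" where
  "linear_operator T \<longleftrightarrow>
     T \<subseteq> ell2 \<times> ell2 \<and> single_valued T \<and> linear_submanifold (Domain T) \<and>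
     (\<forall>h u k v. (h, u) \<in> T \<and> (k, v) \<in> T \<longrightarrow> ((\<lambda>j. h j + k j), (\<lambda>j. u j + v j)) \<in> T) \<and>
     (\<forall>c h u. (h, u) \<in> T \<longrightarrow> ((\<lambda>j. c * h j), (\<lambda>j. c * u j)) \<in> T)"

definition op_apply :: "'j operator \<Rightarrow> ('j \<Rightarrow> complex) \<Rightarrow> ('j \<Rightarrow> complex)" where
  "op_apply T h = (THE u. (h, u) \<in> T)"

definition densely_defined :: "'j operator \<Rightarrow> bool" where
  "densely_defined T \<longleftrightarrow>
     (\<forall>h\<in>ell2. \<forall>\<epsilon>>0. \<exists>k\<in>Domain T. ell2_norm (\<lambda>j. h j - k j) < \<epsilon>)"

text \<open>Meaningful for densely defined operators only; otherwise it is not single-valued.\<close>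

definition adjoint_op :: "'j operator \<Rightarrow> 'j operator" where
  "adjoint_op T = {(k, w). k \<in> ell2 \<and> w \<in> ell2 \<and>
     (\<forall>(h, u) \<in> T. ell2_inner u k = ell2_inner h w)}"

definition bounded_operator :: "'j operator \<Rightarrow> bool" where
  "bounded_operator B \<longleftrightarrow>
     linear_operator B \<and> Domain B = ell2 \<and>
     (\<exists>C. \<forall>(h, u) \<in> B. ell2_norm u \<le> C * ell2_norm h)"

text \<open>The supremum is meaningful for bounded operators only.\<close>

definition op_norm :: "'j operator \<Rightarrow> real" where
  "op_norm B = Sup {ell2_norm u | h u. (h, u) \<in> B \<and> ell2_norm h \<le> 1}"

definition resolvent :: "'j operator \<Rightarrow> complex \<Rightarrow> 'j operator" where
  "resolvent T \<mu> = {((\<lambda>j. u j - \<mu> * h j), h) | h u. (h, u) \<in> T}"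

text \<open>As \<^const>\<open>bounded_operator\<close> demands single-valuedness and the full domain, this says that
  \<open>T - \<mu>\<close> is a bijection from the domain of \<open>T\<close> onto the whole space, with bounded inverse.\<close>

definition resolvent_set :: "'j operator \<Rightarrow> complex set" where
  "resolvent_set T = {\<mu>. bounded_operator (resolvent T \<mu>)}"

text \<open>The point \<open>\<mu> = a\<close> is excluded below, since \<open>Arg 0 = 0 < \<theta>\<close>.\<close>

definition sectorial_with :: "real \<Rightarrow> real \<Rightarrow> 'j operator \<Rightarrow> bool" where
  "sectorial_with \<theta> a T \<longleftrightarrow>
     linear_operator T \<and> densely_defined T \<and> 0 < \<theta> \<and> \<theta> < pi / 2 \<and>
     (\<exists>M>0. \<forall>\<mu>. \<bar>Arg (\<mu> - complex_of_real a)\<bar> \<ge> \<theta> \<longrightarrow>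
        \<mu> \<in> resolvent_set T \<and>
        op_norm (resolvent T \<mu>) \<le> M / cmod (\<mu> - complex_of_real a))"

definition sectorial :: "'j operator \<Rightarrow> bool" where
  "sectorial T \<longleftrightarrow> (\<exists>\<theta> a. sectorial_with \<theta> a T)"


section \<open>Sesquilinear forms\<close>

definition sesquilinear_form ::
  "('j \<Rightarrow> complex) set \<Rightarrow> (('j \<Rightarrow> complex) \<Rightarrow> ('j \<Rightarrow> complex) \<Rightarrow> complex) \<Rightarrow> bool" where
  "sesquilinear_form D Q \<longleftrightarrow>
     linear_submanifold D \<and>
     (\<forall>h\<in>D. \<forall>h'\<in>D. \<forall>k\<in>D. Q (\<lambda>j. h j + h' j) k = Q h k + Q h' k) \<and>
     (\<forall>c. \<forall>h\<in>D. \<forall>k\<in>D. Q (\<lambda>j. c * h j) k = c * Q h k) \<and>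
     (\<forall>h\<in>D. \<forall>k\<in>D. \<forall>k'\<in>D. Q h (\<lambda>j. k j + k' j) = Q h k + Q h k') \<and>
     (\<forall>c. \<forall>h\<in>D. \<forall>k\<in>D. Q h (\<lambda>j. c * k j) = cnj c * Q h k)"

text \<open>By \<open>Arg 0 = 0\<close> the sector contains its vertex \<open>\<gamma>\<close>.\<close>

definition sectorial_form ::
  "('j \<Rightarrow> complex) set \<Rightarrow> (('j \<Rightarrow> complex) \<Rightarrow> ('j \<Rightarrow> complex) \<Rightarrow> complex) \<Rightarrow> bool" where
  "sectorial_form D Q \<longleftrightarrow>
     sesquilinear_form D Q \<and>
     (\<exists>\<gamma>::real. \<exists>\<theta>'\<ge>0. \<theta>' < pi / 2 \<and>
        (\<forall>h\<in>D. ell2_norm h = 1 \<longrightarrow> \<bar>Arg (Q h h - complex_of_real \<gamma>)\<bar> \<le> \<theta>'))"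


section \<open>Diagonal operators and the two forms\<close>

definition diag_op :: "('j \<Rightarrow> complex) \<Rightarrow> 'j operator" where
  "diag_op d = {(h, (\<lambda>j. d j * h j)) | h. h \<in> ell2 \<and> (\<lambda>j. d j * h j) \<in> ell2}"

text \<open>On the complement of the negative real axis, which contains every entry of a sectorial
  diagonal operator with vertex 0, \<^const>\<open>csqrt\<close> is the principal square root.\<close>

definition R_op :: "('j \<Rightarrow> complex) \<Rightarrow> 'j operator" where
  "R_op l = diag_op (\<lambda>j. csqrt (l j))"

definition Q_R ::
  "('j \<Rightarrow> complex) \<Rightarrow> ('j \<Rightarrow> complex) \<Rightarrow> ('j \<Rightarrow> complex) \<Rightarrow> complex" where
  "Q_R l h k = ell2_inner (op_apply (R_op l) h) (op_apply (adjoint_op (R_op l)) k)"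

definition Q_fg_defined ::
  "('j \<Rightarrow> complex) \<Rightarrow> ('j \<Rightarrow> complex) \<Rightarrow> ('j \<Rightarrow> complex) \<Rightarrow> ('j \<Rightarrow> complex) \<Rightarrow> bool" where
  "Q_fg_defined f g h k \<longleftrightarrow>
     (\<lambda>j. h j * cnj (g j)) summable_on UNIV \<and> (\<lambda>j. f j * cnj (k j)) summable_on UNIV"

definition Q_fg ::
  "('j \<Rightarrow> complex) \<Rightarrow> ('j \<Rightarrow> complex) \<Rightarrow> ('j \<Rightarrow> complex) \<Rightarrow> ('j \<Rightarrow> complex) \<Rightarrow> complex" where
  "Q_fg f g h k = (\<Sum>\<^sub>\<infinity>j. h j * cnj (g j)) * (\<Sum>\<^sub>\<infinity>j. f j * cnj (k j))"


section \<open>Consistency of the definitions of the square root and of the adjoint\<close>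

lemma R_op_square: "R_op l O R_op l = diag_op l"
proof -
  have sq: "csqrt (l j) * (csqrt (l j) * h j) = l j * h j" for j and h :: "'a \<Rightarrow> complex"
    by (metis mult.assoc power2_csqrt power2_eq_square)
  have mid: "(\<lambda>j. csqrt (l j) * h j) \<in> ell2" if "h \<in> ell2" "(\<lambda>j. l j * h j) \<in> ell2" for h
  proof -
    have "(\<lambda>j. (cmod (h j))\<^sup>2 + (cmod (l j * h j))\<^sup>2) summable_on UNIV"
      using that by (intro summable_on_add) (auto simp: ell2_def)
    moreover have "(cmod (csqrt (l j) * h j))\<^sup>2 \<le> (cmod (h j))\<^sup>2 + (cmod (l j * h j))\<^sup>2" for j
    proof -
      have c: "(cmod (csqrt (l j)))\<^sup>2 = cmod (l j)"
        by (metis norm_power power2_csqrt)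
      have "cmod (l j) \<le> 1 + (cmod (l j))\<^sup>2"
      proof -
        have "0 \<le> (cmod (l j))\<^sup>2 + 1 - 2 * cmod (l j)"
          using zero_le_power2[of "cmod (l j) - 1"] by (simp add: power2_diff)
        with norm_ge_zero[of "l j"] show ?thesis by linarith
      qed
      from mult_right_mono[OF this zero_le_power2[of "cmod (h j)"]] show ?thesis
        by (simp add: norm_mult power_mult_distrib c algebra_simps)
    qed
    ultimately show ?thesis
      unfolding ell2_def mem_Collect_eq by (rule summable_on_comparison_test) auto
  qed
  show ?thesis
  proof (intro equalityI subrelI)
    fix h u assume "(h, u) \<in> R_op l O R_op l"
    then show "(h, u) \<in> diag_op l"
      by (auto simp: R_op_def diag_op_def sq)
  next
    fix h u assume "(h, u) \<in> diag_op l"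
    then have h: "h \<in> ell2" "(\<lambda>j. l j * h j) \<in> ell2" and u: "u = (\<lambda>j. l j * h j)"
      by (auto simp: diag_op_def)
    have "(h, (\<lambda>j. csqrt (l j) * h j)) \<in> R_op l" "((\<lambda>j. csqrt (l j) * h j), u) \<in> R_op l"
      using h mid[OF h] by (auto simp: R_op_def diag_op_def sq u)
    then show "(h, u) \<in> R_op l O R_op l" by blast
  qed
qed

lemma adjoint_diag_op: "adjoint_op (diag_op d) = diag_op (\<lambda>j. cnj (d j))"
proof (intro equalityI subrelI)
  fix k w assume kw: "(k, w) \<in> adjoint_op (diag_op d)"
  have "w i = cnj (d i) * k i" for i
  proof -
    define e where "e = (\<lambda>j. if j = i then 1 else (0::complex))"
    have fin: "(\<lambda>j. if j = i then a else (0::real)) summable_on UNIV" for a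
      by (rule finite_nonzero_values_imp_summable_on) (auto intro: finite_subset[of _ "{i}"])
    have "(\<lambda>j. (cmod (e j))\<^sup>2) = (\<lambda>j. if j = i then 1 else 0)"
      "(\<lambda>j. (cmod (d j * e j))\<^sup>2) = (\<lambda>j. if j = i then (cmod (d i))\<^sup>2 else 0)"
      by (auto simp: e_def)
    then have "(e, (\<lambda>j. d j * e j)) \<in> diag_op d"
      unfolding diag_op_def ell2_def using fin by auto
    with kw have "ell2_inner (\<lambda>j. d j * e j) k = ell2_inner e w"
      unfolding adjoint_op_def by auto
    moreover have "ell2_inner (\<lambda>j. d j * e j) k = d i * cnj (k i)"
      unfolding ell2_inner_def
      by (subst infsum_cong_neutral[where T = "{i}" and g = "\<lambda>j. d j * cnj (k j)"])
        (auto simp: e_def)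
    moreover have "ell2_inner e w = cnj (w i)"
      unfolding ell2_inner_def
      by (subst infsum_cong_neutral[where T = "{i}" and g = "\<lambda>j. cnj (w j)"])
        (auto simp: e_def)
    ultimately show ?thesis
      by (metis complex_cnj_cnj complex_cnj_mult)
  qed
  then have "w = (\<lambda>j. cnj (d j) * k j)" by auto
  then show "(k, w) \<in> diag_op (\<lambda>j. cnj (d j))"
    using kw by (auto simp: adjoint_op_def diag_op_def)
next
  fix k w assume "(k, w) \<in> diag_op (\<lambda>j. cnj (d j))"
  then show "(k, w) \<in> adjoint_op (diag_op d)"
    by (auto simp: adjoint_op_def diag_op_def ell2_inner_def mult_ac)
qed

end

theory Submission
  imports Defs
begin

text \<open>Write \<open>w j = 1 + \<bar>l j\<bar>\<close>. The domain of the square root is the weighted space of all \<open>h\<close> with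
  \<open>\<Sum> w j * \<bar>h j\<bar>\<^sup>2\<close> finite, and the hypotheses on \<open>f\<close> and \<open>g\<close> say that they lie in the space with weight
  \<open>1 / w\<close>, which is its dual under the \<open>\<ell>\<^sup>2\<close> pairing. So both functionals in the perturbation are
  bounded on the form domain, and the whole form is the pairing \<open>Q(h, k) = \<langle>A h, k\<rangle>\<close> with
  \<open>A h = l h + \<langle>h, g\<rangle> f\<close>, a family that is in general only in the dual space. The operator wanted is
  the part of \<open>A\<close> that takes values in \<open>\<ell>\<^sup>2\<close>.

  The form is sectorial for the following reason. A dual family becomes small in the dual norm once finitely many entries
  are removed, and the removed part is in \<open>\<ell>\<^sup>2\<close>. Hence a dual functional is bounded by an arbitrarily
  small multiple of the form norm plus a multiple of the \<open>\<ell>\<^sup>2\<close> norm (\<open>pairing_small_bound\<close>). The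
  perturbation is then absorbed by the real part of the diagonal form, at the price of a vertex \<open>\<gamma>\<close>
  far to the left (\<open>form_sector_bound\<close>).

  Outside a larger sector with the same vertex the form is coercive, because points of
  the two sectors are at a distance comparable to their moduli (\<open>sector_separation\<close>,
  \<open>coercive_pairing\<close>). Coercivity gives injectivity of \<open>A - \<mu>\<close> and the bound \<open>M / \<bar>\<mu> - \<gamma>\<bar>\<close>. For
  surjectivity the equation is solved explicitly: as \<open>A\<close> is diagonal plus rank one,
  \<open>(A - \<mu>) h = u\<close> reduces to one scalar equation \<open>c * (1 + \<langle>f / (l - \<mu>), g\<rangle>) = \<langle>u / (l - \<mu>), g\<rangle>\<close>, and
  if its coefficient were zero then \<open>f / (l - \<mu>)\<close> would be a nonzero element of the kernel
  (\<open>shifted_action_surjective\<close>).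

  The operator domain is dense: for \<open>u\<close> of finite support the solution of \<open>(A - \<gamma> + \<nu>) k = \<nu> u\<close>
  lies in the operator domain, and coercivity applied to \<open>k - u\<close> shows that \<open>k\<close> tends to \<open>u\<close> as
  \<open>\<nu>\<close> tends to infinity (\<open>densely_defined_form_operator\<close>).

  For uniqueness, testing with unit vectors shows that any representing operator is a restriction of the
  part of \<open>A\<close> in \<open>\<ell>\<^sup>2\<close>. If it is sectorial, then some \<open>T - x\<close> with \<open>x\<close> far to the left is onto while
  \<open>A - x\<close> is injective, so the restriction is not proper (\<open>form_operator_unique\<close>).\<close>


section \<open>Weighted square-summable families\<close>

definition weighted_ell2 :: "('j \<Rightarrow> real) \<Rightarrow> ('j \<Rightarrow> complex) set" where
  "weighted_ell2 w = {h. (\<lambda>j. w j * (cmod (h j))\<^sup>2) summable_on UNIV}"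

definition weighted_sq :: "('j \<Rightarrow> real) \<Rightarrow> ('j \<Rightarrow> complex) \<Rightarrow> real" where
  "weighted_sq w h = (\<Sum>\<^sub>\<infinity>j. w j * (cmod (h j))\<^sup>2)"

lemma ell2_eq_weighted_ell2: "ell2 = weighted_ell2 (\<lambda>_. 1)"
  by (simp add: ell2_def weighted_ell2_def)

lemma ell2_norm_eq_weighted_sq: "ell2_norm h = sqrt (weighted_sq (\<lambda>_. 1) h)"
  by (simp add: ell2_norm_def weighted_sq_def)

lemma norm_add_sq_le: "(norm (x + y))\<^sup>2 \<le> 2 * (norm x)\<^sup>2 + 2 * (norm y)\<^sup>2"
  for x y :: "'a::real_normed_vector"
proof -
  have "(norm (x + y))\<^sup>2 \<le> (norm x + norm y)\<^sup>2"
    by (intro power_mono norm_triangle_ineq) auto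
  also have "\<dots> \<le> 2 * (norm x)\<^sup>2 + 2 * (norm y)\<^sup>2"
    using sum_squares_bound[of "norm x" "norm y"] by (simp add: power2_sum)
  finally show ?thesis .
qed

text \<open>For passing between different weights: the inclusions among form domain, \<open>\<ell>\<^sup>2\<close> and dual space, and the
  mapping properties of multiplication operators between them, are entrywise estimates of this kind.\<close>

lemma weighted_ell2_comparison:
  assumes "h \<in> weighted_ell2 v"
    and "\<And>j. 0 \<le> w j" and "\<And>j. w j * (cmod (k j))\<^sup>2 \<le> c * (v j * (cmod (h j))\<^sup>2)"
  shows "k \<in> weighted_ell2 w" "weighted_sq w k \<le> c * weighted_sq v h"
proof -
  have s: "(\<lambda>j. c * (v j * (cmod (h j))\<^sup>2)) summable_on UNIV"
    using assms(1) by (auto simp: weighted_ell2_def intro: summable_on_cmult_right)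
  show k: "k \<in> weighted_ell2 w"
    unfolding weighted_ell2_def mem_Collect_eq
    by (rule summable_on_comparison_test[OF s]) (use assms(2,3) in auto)
  have "weighted_sq w k \<le> (\<Sum>\<^sub>\<infinity>j. c * (v j * (cmod (h j))\<^sup>2))"
    using k s assms(3) unfolding weighted_sq_def weighted_ell2_def by (intro infsum_mono) auto
  then show "weighted_sq w k \<le> c * weighted_sq v h"
    by (simp add: weighted_sq_def infsum_cmult_right')
qed

lemma weighted_sq_nonneg: "(\<And>j. 0 \<le> w j) \<Longrightarrow> 0 \<le> weighted_sq w h"
  by (simp add: weighted_sq_def infsum_nonneg)

lemma weighted_ell2_scale:
  assumes "h \<in> weighted_ell2 w"
  shows "(\<lambda>j. c * h j) \<in> weighted_ell2 w"
proof -
  have "(\<lambda>j. (cmod c)\<^sup>2 * (w j * (cmod (h j))\<^sup>2)) summable_on UNIV"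
    using assms by (auto simp: weighted_ell2_def intro: summable_on_cmult_right)
  then show ?thesis
    by (simp add: weighted_ell2_def norm_mult power_mult_distrib mult_ac)
qed

lemma weighted_ell2_add:
  assumes w: "\<And>j. 0 \<le> w j" and h: "h \<in> weighted_ell2 w" and k: "k \<in> weighted_ell2 w"
  shows "(\<lambda>j. h j + k j) \<in> weighted_ell2 w"
    and "weighted_sq w (\<lambda>j. h j + k j) \<le> 2 * weighted_sq w h + 2 * weighted_sq w k"
proof -
  have sh: "(\<lambda>j. 2 * (w j * (cmod (h j))\<^sup>2)) summable_on UNIV"
    and sk: "(\<lambda>j. 2 * (w j * (cmod (k j))\<^sup>2)) summable_on UNIV"
    using h k by (auto simp: weighted_ell2_def intro: summable_on_cmult_right)
  note s = summable_on_add[OF sh sk]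
  have le: "w j * (cmod (h j + k j))\<^sup>2 \<le> 2 * (w j * (cmod (h j))\<^sup>2) + 2 * (w j * (cmod (k j))\<^sup>2)" for j
    using mult_left_mono[OF norm_add_sq_le[of "h j" "k j"] w[of j]] by (simp add: algebra_simps)
  have "(\<lambda>j. w j * (cmod (h j + k j))\<^sup>2) summable_on UNIV"
    by (rule summable_on_comparison_test[OF s]) (use le w in auto)
  then show sum: "(\<lambda>j. h j + k j) \<in> weighted_ell2 w"
    by (simp add: weighted_ell2_def)
  have "weighted_sq w (\<lambda>j. h j + k j)
      \<le> (\<Sum>\<^sub>\<infinity>j. 2 * (w j * (cmod (h j))\<^sup>2) + 2 * (w j * (cmod (k j))\<^sup>2))"
    unfolding weighted_sq_def
    using sum s le by (intro infsum_mono) (auto simp: weighted_ell2_def)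
  also have "\<dots> = 2 * weighted_sq w h + 2 * weighted_sq w k"
    by (simp only: infsum_add[OF sh sk] weighted_sq_def infsum_cmult_right')
  finally show "weighted_sq w (\<lambda>j. h j + k j) \<le> 2 * weighted_sq w h + 2 * weighted_sq w k" .
qed

lemma weighted_ell2_diff:
  assumes "\<And>j. 0 \<le> w j" "h \<in> weighted_ell2 w" "k \<in> weighted_ell2 w"
  shows "(\<lambda>j. h j - k j) \<in> weighted_ell2 w"
  using weighted_ell2_add(1)[OF assms(1,2) weighted_ell2_scale[OF assms(3), of "-1"]] by simp

lemma weighted_sq_uminus: "weighted_sq w (\<lambda>j. - h j) = weighted_sq w h"
  by (simp add: weighted_sq_def)

lemma weighted_ell2_finite_support:
  assumes "finite F" "\<And>j. j \<notin> F \<Longrightarrow> h j = 0"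
  shows "h \<in> weighted_ell2 w"
proof -
  have "(\<lambda>j. w j * (cmod (h j))\<^sup>2) summable_on F"
    using assms(1) by simp
  then show ?thesis
    unfolding weighted_ell2_def mem_Collect_eq
    by (subst summable_on_cong_neutral[where T = F and g = "\<lambda>j. w j * (cmod (h j))\<^sup>2"])
      (use assms(2) in auto)
qed

lemma weighted_sq_eq_0D:
  assumes w: "\<And>j. 0 < w j" and "h \<in> weighted_ell2 w" "weighted_sq w h \<le> 0"
  shows "h j = 0"
proof -
  have "w j * (cmod (h j))\<^sup>2 = 0"
    by (rule nonneg_infsum_le_0D[of "\<lambda>j. w j * (cmod (h j))\<^sup>2" UNIV])
      (use assms in \<open>auto simp: weighted_ell2_def weighted_sq_def less_imp_le\<close>)
  then show ?thesis using w[of j] by simp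
qed

text \<open>The square of the weighted norm is an unordered sum of nonnegative terms, so what finitely many
  entries leave over is arbitrarily small.\<close>

lemma weighted_sq_tail:
  assumes h: "h \<in> weighted_ell2 w" and "0 < e"
  obtains F where "finite F" "weighted_sq w (\<lambda>j. if j \<in> F then 0 else h j) \<le> e"
proof -
  let ?f = "\<lambda>j. w j * (cmod (h j))\<^sup>2"
  have s: "?f summable_on UNIV" using h by (simp add: weighted_ell2_def)
  from infsum_finite_approximation[OF this \<open>0 < e\<close>] obtain F
    where F: "finite F" "dist (sum ?f F) (infsum ?f UNIV) \<le> e" by auto
  have sF: "?f summable_on (-F)"
    using s by (rule summable_on_subset_banach) auto
  have "infsum ?f UNIV = infsum ?f (F \<union> -F)" by simp
  also have "\<dots> = sum ?f F + infsum ?f (-F)"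
    using F sF by (subst infsum_Un_disjoint) auto
  finally have "infsum ?f (-F) \<le> e"
    using F(2) by (simp add: dist_real_def)
  moreover have "infsum ?f (-F) = weighted_sq w (\<lambda>j. if j \<in> F then 0 else h j)"
    unfolding weighted_sq_def by (rule infsum_cong_neutral) auto
  ultimately show ?thesis using F(1) that by simp
qed

text \<open>The inequality for finite sums bounds all partial sums of the nonnegative family of products;
  summability and the bound on the limit follow together.\<close>

lemma Cauchy_Schwarz_infsum:
  fixes x y :: "'a \<Rightarrow> real"
  assumes x: "(\<lambda>j. (x j)\<^sup>2) summable_on UNIV" and y: "(\<lambda>j. (y j)\<^sup>2) summable_on UNIV"
  shows "(\<lambda>j. \<bar>x j\<bar> * \<bar>y j\<bar>) summable_on UNIV"
    and "(\<Sum>\<^sub>\<infinity>j. \<bar>x j\<bar> * \<bar>y j\<bar>) \<le> sqrt (\<Sum>\<^sub>\<infinity>j. (x j)\<^sup>2) * sqrt (\<Sum>\<^sub>\<infinity>j. (y j)\<^sup>2)"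
proof -
  let ?B = "sqrt (\<Sum>\<^sub>\<infinity>j. (x j)\<^sup>2) * sqrt (\<Sum>\<^sub>\<infinity>j. (y j)\<^sup>2)"
  have B: "(\<Sum>j\<in>F. \<bar>x j\<bar> * \<bar>y j\<bar>) \<le> ?B" if "finite F" for F
  proof -
    have "(\<Sum>j\<in>F. \<bar>x j\<bar> * \<bar>y j\<bar>) \<le> L2_set x F * L2_set y F"
      by (rule L2_set_mult_ineq)
    also have "\<dots> \<le> ?B"
      unfolding L2_set_def using that x y
      by (intro mult_mono real_sqrt_le_mono finite_sum_le_infsum) (auto intro: sum_nonneg infsum_nonneg)
    finally show ?thesis .
  qed
  show s: "(\<lambda>j. \<bar>x j\<bar> * \<bar>y j\<bar>) summable_on UNIV"
    by (rule nonneg_bdd_above_summable_on) (use B in \<open>auto intro!: bdd_aboveI[of _ ?B]\<close>)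
  show "(\<Sum>\<^sub>\<infinity>j. \<bar>x j\<bar> * \<bar>y j\<bar>) \<le> ?B"
    by (rule infsum_le_finite_sums[OF s]) (use B in auto)
qed

text \<open>The \<open>\<ell>\<^sup>2\<close> pairing puts the spaces with weights \<open>1 / w\<close> and \<open>w\<close> in duality: split each product as
  \<open>(\<bar>a j\<bar> / \<surd>w j) * (\<surd>w j * \<bar>b j\<bar>)\<close>.\<close>

lemma weighted_Cauchy_Schwarz:
  assumes w: "\<And>j. 0 < w j"
    and a: "a \<in> weighted_ell2 (\<lambda>j. 1 / w j)" and b: "b \<in> weighted_ell2 w"
  shows "(\<lambda>j. a j * cnj (b j)) summable_on UNIV"
    and "cmod (ell2_inner a b) \<le> sqrt (weighted_sq (\<lambda>j. 1 / w j) a) * sqrt (weighted_sq w b)"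
proof -
  define x where "x j = cmod (a j) / sqrt (w j)" for j
  define y where "y j = sqrt (w j) * cmod (b j)" for j
  have w': "0 \<le> w j" "w j \<noteq> 0" for j using w[of j] by auto
  have x2: "(x j)\<^sup>2 = 1 / w j * (cmod (a j))\<^sup>2" and y2: "(y j)\<^sup>2 = w j * (cmod (b j))\<^sup>2"
    and xy: "\<bar>x j\<bar> * \<bar>y j\<bar> = cmod (a j * cnj (b j))" for j
    using w' by (simp_all add: x_def y_def power_divide power_mult_distrib norm_mult abs_mult)
  have "(\<lambda>j. (x j)\<^sup>2) summable_on UNIV" "(\<lambda>j. (y j)\<^sup>2) summable_on UNIV"
    using a b by (simp_all add: x2 y2 weighted_ell2_def)
  note cs = Cauchy_Schwarz_infsum[OF this, unfolded xy]
  show "(\<lambda>j. a j * cnj (b j)) summable_on UNIV"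
    by (rule abs_summable_summable[OF cs(1)])
  have "cmod (ell2_inner a b) \<le> (\<Sum>\<^sub>\<infinity>j. cmod (a j * cnj (b j)))"
    unfolding ell2_inner_def by (rule norm_infsum_bound[OF cs(1)])
  also have "\<dots> \<le> sqrt (weighted_sq (\<lambda>j. 1 / w j) a) * sqrt (weighted_sq w b)"
    using cs(2) by (simp only: weighted_sq_def x2 y2)
  finally show "cmod (ell2_inner a b)
      \<le> sqrt (weighted_sq (\<lambda>j. 1 / w j) a) * sqrt (weighted_sq w b)" .
qed

lemma ell2_inner_commute: "ell2_inner a b = cnj (ell2_inner b a)"
  by (simp add: ell2_inner_def flip: infsum_cnj) (simp add: mult.commute)

lemma ell2_inner_unit: "ell2_inner a (\<lambda>j. if j = i then 1 else 0) = a i"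
  unfolding ell2_inner_def
  by (subst infsum_cong_neutral[where T = "{i}" and g = "\<lambda>j. a j"]) auto

lemma ell2_inner_scale_left: "ell2_inner (\<lambda>j. c * a j) b = c * ell2_inner a b"
  by (simp add: ell2_inner_def mult.assoc infsum_cmult_right')

lemma ell2_inner_scale_right: "ell2_inner a (\<lambda>j. c * b j) = cnj c * ell2_inner a b"
  by (simp add: ell2_inner_def mult.left_commute infsum_cmult_right')

lemma ell2_inner_self:
  assumes "h \<in> ell2"
  shows "ell2_inner h h = of_real (weighted_sq (\<lambda>_. 1) h)"
proof -
  have "((\<lambda>j. of_real ((cmod (h j))\<^sup>2)) has_sum complex_of_real (weighted_sq (\<lambda>_. 1) h)) UNIV"
    using has_sum_of_real[OF has_sum_infsum, of "\<lambda>j. (cmod (h j))\<^sup>2" UNIV] assms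
    by (simp add: ell2_def weighted_sq_def del: of_real_power)
  then have "((\<lambda>j. h j * cnj (h j)) has_sum complex_of_real (weighted_sq (\<lambda>_. 1) h)) UNIV"
    by (simp only: complex_norm_square)
  then show ?thesis unfolding ell2_inner_def by (rule infsumI)
qed

lemma summable_pairing_swapped:
  assumes w: "\<And>j. 0 < w j"
    and b: "b \<in> weighted_ell2 w" and a: "a \<in> weighted_ell2 (\<lambda>j. 1 / w j)"
  shows "(\<lambda>j. b j * cnj (a j)) summable_on UNIV"
  using weighted_Cauchy_Schwarz(1)[of "\<lambda>j. 1 / w j" b a] assms by auto

lemma ell2_inner_add_left:
  assumes "(\<lambda>j. a j * cnj (b j)) summable_on UNIV" "(\<lambda>j. a' j * cnj (b j)) summable_on UNIV"
  shows "ell2_inner (\<lambda>j. a j + a' j) b = ell2_inner a b + ell2_inner a' b"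
  unfolding ell2_inner_def using infsum_add[OF assms] by (simp add: algebra_simps)

lemma ell2_inner_add_right:
  assumes "(\<lambda>j. a j * cnj (b j)) summable_on UNIV" "(\<lambda>j. a j * cnj (b' j)) summable_on UNIV"
  shows "ell2_inner a (\<lambda>j. b j + b' j) = ell2_inner a b + ell2_inner a b'"
  unfolding ell2_inner_def using infsum_add[OF assms] by (simp add: algebra_simps)

lemma ell2_Cauchy_Schwarz:
  assumes "a \<in> ell2" "b \<in> ell2"
  shows "cmod (ell2_inner a b) \<le> ell2_norm a * ell2_norm b"
  using weighted_Cauchy_Schwarz(2)[of "\<lambda>_. 1" a b] assms
  by (simp_all add: ell2_eq_weighted_ell2 ell2_norm_eq_weighted_sq)

lemma finite_support_ell2: "finite F \<Longrightarrow> (\<And>j. j \<notin> F \<Longrightarrow> h j = 0) \<Longrightarrow> h \<in> ell2"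
  by (simp add: ell2_eq_weighted_ell2 weighted_ell2_finite_support)

lemma linear_submanifold_weighted_ell2:
  assumes "weighted_ell2 w \<subseteq> ell2" "\<And>j. 0 \<le> w j"
  shows "linear_submanifold (weighted_ell2 w)"
  unfolding linear_submanifold_def using assms weighted_ell2_finite_support[of "{}" "\<lambda>_. 0" w]
  by (auto intro: weighted_ell2_scale weighted_ell2_add(1))

lemma ell2_closed:
  shows ell2_zero: "(\<lambda>_. 0) \<in> ell2"
    and ell2_add: "h \<in> ell2 \<Longrightarrow> k \<in> ell2 \<Longrightarrow> (\<lambda>j. h j + k j) \<in> ell2"
    and ell2_scale: "h \<in> ell2 \<Longrightarrow> (\<lambda>j. c * h j) \<in> ell2"
  using linear_submanifold_weighted_ell2[of "\<lambda>_. 1"]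
  by (auto simp: linear_submanifold_def ell2_eq_weighted_ell2)

lemma ell2_diff: "h \<in> ell2 \<Longrightarrow> k \<in> ell2 \<Longrightarrow> (\<lambda>j. h j - k j) \<in> ell2"
  using ell2_add[OF _ ell2_scale[of k "-1"], of h] by simp

lemma ell2_norm_nonneg: "0 \<le> ell2_norm h"
  by (simp add: ell2_norm_eq_weighted_sq weighted_sq_nonneg)

lemma ell2_norm_sq: "(ell2_norm h)\<^sup>2 = weighted_sq (\<lambda>_. 1) h"
  by (simp add: ell2_norm_eq_weighted_sq weighted_sq_nonneg)

lemma ell2_norm_zero: "ell2_norm (\<lambda>_. 0) = 0"
  by (simp add: ell2_norm_def)

lemma ell2_norm_eq_0D: "h \<in> ell2 \<Longrightarrow> ell2_norm h = 0 \<Longrightarrow> h j = 0"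
  using weighted_sq_eq_0D[of "\<lambda>_. 1" h] by (simp add: ell2_norm_eq_weighted_sq ell2_eq_weighted_ell2)


section \<open>Sectors in the complex plane\<close>

text \<open>With \<open>d = \<bar>z - y\<bar>\<close>, the difference of the moduli is at most \<open>d\<close>, and so is
  \<open>a * \<bar>z\<bar> - b * \<bar>y\<bar>\<close>, a lower bound for the real part of \<open>z - y\<close>. As \<open>b < a\<close>, these two linear
  inequalities bound the moduli: \<open>(a - b) * \<bar>z\<bar> \<le> 2 * d\<close> and \<open>(a - b) * \<bar>y\<bar> \<le> 3 * d\<close>.\<close>

lemma sector_separation:
  fixes z y :: complex
  assumes z: "a * cmod z \<le> Re z" and y: "Re y \<le> b * cmod y"
    and "0 \<le> b" "b < a" "a \<le> 1"
  shows "(a - b) / 5 * (cmod z + cmod y) \<le> cmod (z - y)"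
proof -
  let ?t = "cmod (z - y)"
  have diff: "\<bar>cmod z - cmod y\<bar> \<le> ?t" by (rule norm_triangle_ineq3)
  have "a * cmod z - b * cmod y \<le> ?t"
    using z y abs_Re_le_cmod[of "z - y"] by simp
  then have "(a - b) * cmod z \<le> ?t + b * (cmod y - cmod z)"
    by (simp add: algebra_simps)
  also have "b * (cmod y - cmod z) \<le> b * ?t"
    using diff \<open>0 \<le> b\<close> by (intro mult_left_mono) auto
  also have "b * ?t \<le> 1 * ?t"
    using assms(3-5) by (intro mult_right_mono) auto
  finally have 1: "(a - b) * cmod z \<le> 2 * ?t" by simp
  have "(a - b) * cmod y \<le> (a - b) * (cmod z + ?t)"
    using diff \<open>b < a\<close> by (intro mult_left_mono) auto
  also have "\<dots> = (a - b) * cmod z + (a - b) * ?t"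
    by (simp add: algebra_simps)
  also have "(a - b) * ?t \<le> 1 * ?t"
    using assms(3-5) by (intro mult_right_mono) auto
  finally have 2: "(a - b) * cmod y \<le> 3 * ?t" using 1 by simp
  have "(a - b) * (cmod z + cmod y) \<le> 5 * ?t"
    using 1 2 by (simp add: algebra_simps)
  then show ?thesis by (simp add: field_simps)
qed

lemma cmod_cos_Arg: "cmod z * cos (Arg z) = Re z"
  by (cases "z = 0") (auto simp: cos_Arg)

text \<open>Sectors are handled through the inequality \<open>a * \<bar>z\<bar> \<le> Re z\<close> with \<open>a\<close> the cosine of the half-angle,
  which is homogeneous and includes \<open>z = 0\<close>. The next three lemmas translate
  from and to arguments.\<close>

lemma sector_cosD:
  assumes "\<bar>Arg z\<bar> \<le> t" "t \<le> pi" shows "cos t * cmod z \<le> Re z"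
proof -
  have "cos t \<le> cos \<bar>Arg z\<bar>" using assms by (intro cos_monotone_0_pi_le) auto
  then have "cmod z * cos t \<le> cmod z * cos (Arg z)"
    by (simp add: mult_left_mono)
  then show ?thesis by (simp add: cmod_cos_Arg mult.commute)
qed

lemma sector_cosI:
  assumes "a * cmod z \<le> Re z" "0 \<le> a" "a \<le> 1"
  shows "\<bar>Arg z\<bar> \<le> arccos a"
proof (cases "z = 0")
  case True
  then show ?thesis using assms by (simp add: Arg_zero arccos_lbound)
next
  case False
  have "arccos (cos \<bar>Arg z\<bar>) = \<bar>Arg z\<bar>"
    using Arg_bounded[of z] by (intro arccos_cos) auto
  moreover have "a \<le> cos \<bar>Arg z\<bar>"
    using assms(1) False by (simp add: cos_Arg field_simps)
  then have "arccos (cos \<bar>Arg z\<bar>) \<le> arccos a"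
    using assms by (intro arccos_le_arccos) auto
  ultimately show ?thesis by simp
qed

lemma sector_complement_cosD:
  assumes "t \<le> \<bar>Arg z\<bar>" "0 \<le> t" shows "Re z \<le> cos t * cmod z"
proof -
  have "cos \<bar>Arg z\<bar> \<le> cos t"
    using assms Arg_bounded[of z] by (intro cos_monotone_0_pi_le) auto
  then have "cmod z * cos (Arg z) \<le> cmod z * cos t"
    by (simp add: mult_left_mono)
  then show ?thesis by (simp add: cmod_cos_Arg mult.commute)
qed


section \<open>The form of a diagonal operator perturbed by a product of two functionals\<close>

text \<open>Here \<open>\<kappa>\<close> is the cosine of the half-angle of a sector with vertex \<open>0\<close> that contains the entries of the
  diagonal operator.\<close>

locale perturbed_diagonal =
  fixes l f g :: "'j \<Rightarrow> complex" and \<kappa> :: real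
  assumes \<kappa>: "0 < \<kappa>" "\<kappa> \<le> 1"
    and sector: "\<kappa> * cmod (l j) \<le> Re (l j)"
    and f: "f \<in> weighted_ell2 (\<lambda>j. 1 / (1 + cmod (l j)))"
    and g: "g \<in> weighted_ell2 (\<lambda>j. 1 / (1 + cmod (l j)))"
begin

abbreviation w :: "'j \<Rightarrow> real" where "w j \<equiv> 1 + cmod (l j)"

abbreviation form_domain :: "('j \<Rightarrow> complex) set" where "form_domain \<equiv> weighted_ell2 w"

abbreviation form_dual :: "('j \<Rightarrow> complex) set" where
  "form_dual \<equiv> weighted_ell2 (\<lambda>j. 1 / w j)"

abbreviation energy :: "('j \<Rightarrow> complex) \<Rightarrow> real" where "energy \<equiv> weighted_sq w"

abbreviation mass :: "('j \<Rightarrow> complex) \<Rightarrow> real" where "mass \<equiv> weighted_sq (\<lambda>_. 1)"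

text \<open>The distributional action of the perturbed diagonal operator: it maps the form domain into its
  dual, and \<open>\<langle>action h, k\<rangle>\<close> is the form under study.\<close>

definition action :: "('j \<Rightarrow> complex) \<Rightarrow> 'j \<Rightarrow> complex" where
  "action h = (\<lambda>j. l j * h j + ell2_inner h g * f j)"

lemma w_ge_1: "1 \<le> w j" by simp

lemma w_pos: "0 < w j" using w_ge_1[of j] by linarith

lemma form_domain_subset_ell2: "form_domain \<subseteq> ell2"
  and mass_le_energy: "h \<in> form_domain \<Longrightarrow> mass h \<le> energy h"
proof -
  have "h \<in> weighted_ell2 (\<lambda>_. 1) \<and> mass h \<le> energy h" if "h \<in> form_domain" for h
    using weighted_ell2_comparison[OF that, of "\<lambda>_. 1" h 1] by (auto simp: mult_right_mono algebra_simps)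
  then show "form_domain \<subseteq> ell2" "h \<in> form_domain \<Longrightarrow> mass h \<le> energy h"
    by (auto simp: ell2_eq_weighted_ell2)
qed

lemma form_dual_nonneg: "0 \<le> 1 / w j" by (simp add: w_pos less_imp_le)

lemma ell2_subset_form_dual: "ell2 \<subseteq> form_dual"
proof
  fix h :: "'j \<Rightarrow> complex" assume "h \<in> ell2"
  then have h: "h \<in> weighted_ell2 (\<lambda>_. 1)" by (simp add: ell2_eq_weighted_ell2)
  have le: "1 / w j * (cmod (h j))\<^sup>2 \<le> 1 * (1 * (cmod (h j))\<^sup>2)" for j
    using mult_right_mono[of "1 / w j" 1 "(cmod (h j))\<^sup>2"] w_ge_1[of j] w_pos[of j]
    by (simp only: divide_le_eq_1_pos) simp
  show "h \<in> form_dual"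
    by (rule weighted_ell2_comparison(1)[OF h _ le]) (simp add: w_pos less_imp_le)
qed

lemma form_domain_subset_form_dual: "form_domain \<subseteq> form_dual"
  using form_domain_subset_ell2 ell2_subset_form_dual by blast

lemma diag_form_dual:
  assumes "h \<in> form_domain" shows "(\<lambda>j. l j * h j) \<in> form_dual"
proof (rule weighted_ell2_comparison(1)[OF assms])
  show "0 \<le> 1 / w j" for j by (rule form_dual_nonneg)
  fix j
  have "(cmod (l j))\<^sup>2 \<le> (w j)\<^sup>2" by (intro power_mono) auto
  then have "1 / w j * (cmod (l j))\<^sup>2 \<le> w j"
    using w_pos[of j] by (simp add: field_simps power2_eq_square)
  from mult_right_mono[OF this zero_le_power2[of "cmod (h j)"]]
  show "1 / w j * (cmod (l j * h j))\<^sup>2 \<le> 1 * (w j * (cmod (h j))\<^sup>2)"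
    by (simp add: norm_mult power_mult_distrib)
qed

lemma action_form_dual: "h \<in> form_domain \<Longrightarrow> action h \<in> form_dual"
  unfolding action_def
  by (intro weighted_ell2_add(1) weighted_ell2_scale diag_form_dual f form_dual_nonneg)

lemmas pairing = weighted_Cauchy_Schwarz[where w = w, OF w_pos]
  and pairing_swapped = summable_pairing_swapped[where w = w, OF w_pos]

lemma form_domain_add:
  "h \<in> form_domain \<Longrightarrow> k \<in> form_domain \<Longrightarrow> (\<lambda>j. h j + k j) \<in> form_domain"
  by (rule weighted_ell2_add(1)) (auto simp: w_pos less_imp_le)

lemma action_add:
  assumes "h \<in> form_domain" "k \<in> form_domain"
  shows "action (\<lambda>j. h j + k j) = (\<lambda>j. action h j + action k j)"
  using assms g by (simp add: action_def ell2_inner_add_left pairing_swapped algebra_simps)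

lemma action_scale: "action (\<lambda>j. c * h j) = (\<lambda>j. c * action h j)"
  by (simp add: action_def ell2_inner_scale_left algebra_simps)

lemma pairing_add_left:
  assumes "a \<in> form_dual" "b \<in> form_dual" "k \<in> form_domain"
  shows "ell2_inner (\<lambda>j. a j + b j) k = ell2_inner a k + ell2_inner b k"
  using assms by (intro ell2_inner_add_left pairing(1))

lemma pairing_add_right:
  assumes "a \<in> form_dual" "h \<in> form_domain" "k \<in> form_domain"
  shows "ell2_inner a (\<lambda>j. h j + k j) = ell2_inner a h + ell2_inner a k"
  using assms by (intro ell2_inner_add_right pairing(1))

lemma pairing_action:
  assumes "h \<in> form_domain" "k \<in> form_domain"
  shows "ell2_inner (action h) k
    = ell2_inner (\<lambda>j. l j * h j) k + ell2_inner h g * ell2_inner f k"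
  unfolding action_def using assms
  by (simp add: pairing_add_left diag_form_dual f weighted_ell2_scale ell2_inner_scale_left)

text \<open>Write \<open>p = q + r\<close>, where \<open>r\<close> has finite support, hence is in \<open>\<ell>\<^sup>2\<close>, and \<open>q\<close> is small in the dual norm.
  The pairing of \<open>h\<close> with \<open>r\<close> is controlled by the \<open>\<ell>\<^sup>2\<close> norm of \<open>h\<close>, that with \<open>q\<close> by a small multiple of
  its energy. This makes the perturbation form-bounded relative to the diagonal form with relative
  bound zero.\<close>

lemma pairing_small_bound:
  assumes p: "p \<in> form_dual" and "0 < e"
  obtains C where "0 \<le> C"
    "\<And>h. h \<in> form_domain \<Longrightarrow> (cmod (ell2_inner p h))\<^sup>2 \<le> e * energy h + C * mass h"
proof -
  from weighted_sq_tail[OF p, of "e / 2"] \<open>0 < e\<close> obtain F where F: "finite F"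
    and tail: "weighted_sq (\<lambda>j. 1 / w j) (\<lambda>j. if j \<in> F then 0 else p j) \<le> e / 2" by auto
  define q where "q j = (if j \<in> F then 0 else p j)" for j
  define r where "r j = (if j \<in> F then p j else 0)" for j
  have r: "r \<in> weighted_ell2 v" for v
    by (rule weighted_ell2_finite_support[OF F]) (simp add: r_def)
  have "q = (\<lambda>j. p j - r j)" by (auto simp: q_def r_def)
  then have q: "q \<in> form_dual"
    using weighted_ell2_diff[OF form_dual_nonneg p r] by simp
  have split: "p = (\<lambda>j. q j + r j)" by (auto simp: q_def r_def)
  have "(cmod (ell2_inner p h))\<^sup>2 \<le> e * energy h + 2 * mass r * mass h" if h: "h \<in> form_domain" for h
  proof -
    have "ell2_inner p h = ell2_inner q h + ell2_inner r h"
      using pairing_add_left[OF q r h] split by simp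
    then have "(cmod (ell2_inner p h))\<^sup>2 \<le> 2 * (cmod (ell2_inner q h))\<^sup>2 + 2 * (cmod (ell2_inner r h))\<^sup>2"
      using norm_add_sq_le[of "ell2_inner q h" "ell2_inner r h"] by simp
    moreover have "(cmod (ell2_inner q h))\<^sup>2 \<le> e / 2 * energy h"
    proof -
      have "(cmod (ell2_inner q h))\<^sup>2 \<le> (sqrt (weighted_sq (\<lambda>j. 1 / w j) q) * sqrt (energy h))\<^sup>2"
        by (intro power_mono pairing(2) q h) auto
      also have "\<dots> = weighted_sq (\<lambda>j. 1 / w j) q * energy h"
        by (simp add: power_mult_distrib weighted_sq_nonneg w_pos less_imp_le)
      also have "\<dots> \<le> e / 2 * energy h"
        using tail by (intro mult_right_mono weighted_sq_nonneg) (auto simp: q_def[abs_def])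
      finally show ?thesis .
    qed
    moreover have "(cmod (ell2_inner r h))\<^sup>2 \<le> mass r * mass h"
    proof -
      have "(cmod (ell2_inner r h))\<^sup>2 \<le> (ell2_norm r * ell2_norm h)\<^sup>2"
        using r h form_domain_subset_ell2
        by (intro power_mono ell2_Cauchy_Schwarz) (auto simp: ell2_eq_weighted_ell2)
      also have "\<dots> = mass r * mass h"
        by (simp add: ell2_norm_eq_weighted_sq power_mult_distrib weighted_sq_nonneg)
      finally show ?thesis .
    qed
    ultimately show ?thesis by (simp add: algebra_simps)
  qed
  then show ?thesis by (intro that[of "2 * mass r"]) (auto simp: weighted_sq_nonneg)
qed

text \<open>The form of the diagonal operator at \<open>h\<close> is \<open>\<Sum> l j * \<bar>h j\<bar>\<^sup>2\<close>, and \<open>energy h - mass h\<close> is the sum of the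
  moduli of its terms, so the sector condition passes from the entries to the sum.\<close>

lemma diagonal_form_bounds:
  assumes h: "h \<in> form_domain"
  shows "\<kappa> * (energy h - mass h) \<le> Re (ell2_inner (\<lambda>j. l j * h j) h)"
    and "cmod (ell2_inner (\<lambda>j. l j * h j) h) \<le> energy h - mass h"
proof -
  let ?t = "\<lambda>j. l j * of_real ((cmod (h j))\<^sup>2)"
  have h': "(\<lambda>j. w j * (cmod (h j))\<^sup>2) summable_on UNIV" "(\<lambda>j. (cmod (h j))\<^sup>2) summable_on UNIV"
    using h form_domain_subset_ell2 by (auto simp: weighted_ell2_def ell2_def)
  have entry: "l j * h j * cnj (h j) = ?t j" for j
    by (simp only: complex_norm_square mult.assoc)
  have eq: "ell2_inner (\<lambda>j. l j * h j) h = (\<Sum>\<^sub>\<infinity>j. ?t j)"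
    unfolding ell2_inner_def by (simp only: entry)
  have s: "(\<lambda>j. cmod (l j) * (cmod (h j))\<^sup>2) summable_on UNIV"
    by (rule summable_on_comparison_test[OF h'(1)]) (auto simp: algebra_simps)
  have "energy h = (\<Sum>\<^sub>\<infinity>j. (cmod (h j))\<^sup>2 + cmod (l j) * (cmod (h j))\<^sup>2)"
    by (simp add: weighted_sq_def algebra_simps)
  also have "\<dots> = mass h + (\<Sum>\<^sub>\<infinity>j. cmod (l j) * (cmod (h j))\<^sup>2)"
    by (simp add: infsum_add[OF h'(2) s] weighted_sq_def)
  finally have A: "energy h - mass h = (\<Sum>\<^sub>\<infinity>j. cmod (l j) * (cmod (h j))\<^sup>2)" by simp
  have n: "(\<lambda>j. norm (?t j)) summable_on UNIV"
    using s by (simp add: norm_mult norm_power)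
  show "cmod (ell2_inner (\<lambda>j. l j * h j) h) \<le> energy h - mass h"
    using norm_infsum_bound[OF n] by (simp add: eq A norm_mult norm_power)
  note t = abs_summable_summable[OF n]
  have "(\<Sum>\<^sub>\<infinity>j. \<kappa> * (cmod (l j) * (cmod (h j))\<^sup>2)) \<le> (\<Sum>\<^sub>\<infinity>j. Re (?t j))"
  proof (rule infsum_mono)
    show "(\<lambda>j. \<kappa> * (cmod (l j) * (cmod (h j))\<^sup>2)) summable_on UNIV"
      using s by (rule summable_on_cmult_right)
    show "(\<lambda>j. Re (?t j)) summable_on UNIV" using t by (rule summable_on_Re)
    show "\<kappa> * (cmod (l j) * (cmod (h j))\<^sup>2) \<le> Re (?t j)" for j
      using mult_right_mono[OF sector[of j] zero_le_power2[of "cmod (h j)"]]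
      by (simp add: mult.assoc flip: of_real_power)
  qed
  then show "\<kappa> * (energy h - mass h) \<le> Re (ell2_inner (\<lambda>j. l j * h j) h)"
    unfolding eq A infsum_Re[OF t] infsum_cmult_right' .
qed

text \<open>Both functionals are bounded with a share \<open>\<kappa> / 2\<close> of the energy, so that the arithmetic-geometric mean
  inequality leaves half of the lower bound \<open>\<kappa> * energy h\<close> for the diagonal form. The vertex \<open>\<gamma>\<close>
  compensates all multiples of \<open>mass h\<close>. It is taken to be at most \<open>-1\<close>, and the aperture \<open>a\<close> at most
  \<open>\<kappa>\<close>, so that the entries of the diagonal operator also lie in the resulting sector and stay away
  from its vertex.\<close>

lemma form_sector_bound:
  obtains \<gamma> a where "\<gamma> \<le> -1" "0 < a" "a \<le> \<kappa>"
    "\<And>h. h \<in> form_domain \<Longrightarrow>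
       a * cmod (ell2_inner (action h) h - of_real (\<gamma> * mass h))
         \<le> Re (ell2_inner (action h) h - of_real (\<gamma> * mass h))"
    "\<And>h. h \<in> form_domain \<Longrightarrow>
       \<kappa> / 2 * energy h \<le> Re (ell2_inner (action h) h - of_real (\<gamma> * mass h))"
proof -
  obtain C1 where C1: "0 \<le> C1" "\<And>h. h \<in> form_domain \<Longrightarrow>
      (cmod (ell2_inner g h))\<^sup>2 \<le> \<kappa> / 2 * energy h + C1 * mass h"
    using pairing_small_bound[OF g, of "\<kappa> / 2"] \<kappa> by auto
  obtain C2 where C2: "0 \<le> C2" "\<And>h. h \<in> form_domain \<Longrightarrow>
      (cmod (ell2_inner f h))\<^sup>2 \<le> \<kappa> / 2 * energy h + C2 * mass h"
    using pairing_small_bound[OF f, of "\<kappa> / 2"] \<kappa> by auto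
  define C where "C = (C1 + C2) / 2"
  have "0 \<le> C" using C1 C2 by (simp add: C_def)
  define \<gamma> where "\<gamma> = - (C + 1)"
  \<comment> \<open>The shifted form is at most \<open>d * energy h\<close> in modulus, while its real part is at least \<open>\<kappa> / 2 * energy h\<close>.\<close>
  define d where "d = 2 * C + 3"
  have d: "3 \<le> d" using \<open>0 \<le> C\<close> by (simp add: d_def)
  define a where "a = \<kappa> / 2 / d"
  have "\<kappa> * 1 \<le> \<kappa> * (2 * d)" using d \<kappa> by (intro mult_left_mono) auto
  then have a: "0 < a" "a \<le> \<kappa>" using \<kappa> d by (auto simp: a_def field_simps)
  have *: "\<kappa> / 2 * energy h \<le> Re (ell2_inner (action h) h - of_real (\<gamma> * mass h)) \<and>
      a * cmod (ell2_inner (action h) h - of_real (\<gamma> * mass h))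
         \<le> Re (ell2_inner (action h) h - of_real (\<gamma> * mass h))"
    if h: "h \<in> form_domain" for h
  proof -
    define L where "L = ell2_inner (\<lambda>j. l j * h j) h"
    define P where "P = ell2_inner h g * ell2_inner f h"
    define z where "z = ell2_inner (action h) h - of_real (\<gamma> * mass h)"
    have m: "0 \<le> mass h" "mass h \<le> energy h"
      by (auto simp: weighted_sq_nonneg mass_le_energy h)
    have z: "z = L + P + of_real ((C + 1) * mass h)"
      using pairing_action[OF h h] by (simp add: z_def L_def P_def \<gamma>_def algebra_simps)
    have "cmod (ell2_inner h g) = cmod (ell2_inner g h)"
      using ell2_inner_commute[of h g] by (metis complex_mod_cnj)
    then have "cmod P = cmod (ell2_inner g h) * cmod (ell2_inner f h)"
      by (simp add: P_def norm_mult)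
    also have "\<dots> \<le> ((cmod (ell2_inner g h))\<^sup>2 + (cmod (ell2_inner f h))\<^sup>2) / 2"
      using sum_squares_bound[of "cmod (ell2_inner g h)" "cmod (ell2_inner f h)"] by simp
    also have "\<dots> \<le> \<kappa> / 2 * energy h + C * mass h"
      using C1(2)[OF h] C2(2)[OF h] by (simp add: C_def field_simps)
    finally have P: "cmod P \<le> \<kappa> / 2 * energy h + C * mass h" .
    have L: "\<kappa> * energy h - \<kappa> * mass h \<le> Re L" "cmod L \<le> energy h - mass h"
      using diagonal_form_bounds[OF h] by (auto simp: L_def algebra_simps)
    have \<kappa>m: "\<kappa> * mass h \<le> 1 * mass h" "\<kappa> * energy h \<le> 1 * energy h"
      using mult_right_mono[OF \<kappa>(2)] m(1) order.trans[OF m] by blast+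
    have "Re z = Re L + Re P + C * mass h + mass h"
      by (simp add: z algebra_simps)
    moreover have "- cmod P \<le> Re P" using abs_Re_le_cmod[of P] by linarith
    ultimately have lower: "\<kappa> / 2 * energy h \<le> Re z"
      using P L(1) \<kappa>m by (simp add: field_simps)
    have "cmod z \<le> cmod L + cmod P + cmod (complex_of_real ((C + 1) * mass h))"
      unfolding z by (intro order.trans[OF norm_triangle_ineq] add_mono norm_triangle_ineq order.refl)
    also have "cmod (complex_of_real ((C + 1) * mass h)) = C * mass h + mass h"
      using \<open>0 \<le> C\<close> m by (simp only: norm_of_real) (simp add: algebra_simps)
    finally have "cmod z \<le> 2 * energy h + 2 * (C * mass h)"
      using P L(2) \<kappa>m m by (simp add: field_simps)
    also have "\<dots> \<le> 2 * energy h + 2 * (C * energy h)"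
      using m \<open>0 \<le> C\<close> by (simp add: mult_left_mono)
    also have "\<dots> \<le> d * energy h"
      using m by (simp add: d_def algebra_simps)
    finally have "a * cmod z \<le> a * (d * energy h)"
      using a by (intro mult_left_mono) auto
    also have "\<dots> = \<kappa> / 2 * energy h"
      using d by (simp add: a_def)
    finally show ?thesis using lower by (simp add: z_def)
  qed
  show ?thesis
    by (rule that[of \<gamma> a]) (use * a \<open>0 \<le> C\<close> in \<open>auto simp: \<gamma>_def\<close>)
qed

end


section \<open>The resolvent equation outside a sector\<close>

text \<open>Fixes a vertex and an aperture as provided by \<open>form_sector_bound\<close>.\<close>

locale coercive_perturbed_diagonal = perturbed_diagonal l f g \<kappa>
  for l f g :: "'j \<Rightarrow> complex" and \<kappa> :: real +
  fixes \<gamma> a :: real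
  assumes \<gamma>: "\<gamma> \<le> -1" and a: "0 < a" "a \<le> \<kappa>"
    and form_in_sector: "h \<in> form_domain \<Longrightarrow>
       a * cmod (ell2_inner (action h) h - of_real (\<gamma> * mass h))
         \<le> Re (ell2_inner (action h) h - of_real (\<gamma> * mass h))"
    and form_bounds_energy: "h \<in> form_domain \<Longrightarrow>
       \<kappa> / 2 * energy h \<le> Re (ell2_inner (action h) h - of_real (\<gamma> * mass h))"
begin

lemma a_le_1: "a \<le> 1" using a \<kappa> by simp

lemma sesquilinear_action_form:
  "sesquilinear_form form_domain (\<lambda>h k. ell2_inner (action h) k)"
proof -
  have "linear_submanifold form_domain"
    by (rule linear_submanifold_weighted_ell2[OF form_domain_subset_ell2])
      (simp add: w_pos less_imp_le)
  then show ?thesis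
    unfolding sesquilinear_form_def
    by (auto simp: action_add action_scale pairing_add_left pairing_add_right action_form_dual
        ell2_inner_scale_left ell2_inner_scale_right)
qed

lemma sectorial_action_form:
  "sectorial_form form_domain (\<lambda>h k. ell2_inner (action h) k)"
  unfolding sectorial_form_def
proof (intro conjI exI ballI impI)
  show "sesquilinear_form form_domain (\<lambda>h k. ell2_inner (action h) k)"
    by (rule sesquilinear_action_form)
  show "0 \<le> arccos a" using a a_le_1 by (intro arccos_lbound) auto
  have "arccos a < arccos 0" using a a_le_1 by (intro arccos_less_arccos) auto
  then show "arccos a < pi / 2" by simp
  fix h assume h: "h \<in> form_domain" and "ell2_norm h = 1"
  then have "mass h = 1" using ell2_norm_sq[of h] by simp
  then show "\<bar>Arg (ell2_inner (action h) h - complex_of_real \<gamma>)\<bar> \<le> arccos a"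
    using sector_cosI[OF form_in_sector[OF h]] a a_le_1 by simp
qed

text \<open>The closed complement of the sector with vertex \<open>\<gamma>\<close> and cosine \<open>a / 2\<close>. That sector is strictly wider
  than the one, of cosine \<open>a\<close>, that contains the values of the form.\<close>

definition outside_sector :: "complex \<Rightarrow> bool" where
  "outside_sector \<mu> \<longleftrightarrow> Re (\<mu> - of_real \<gamma>) \<le> a / 2 * cmod (\<mu> - of_real \<gamma>)"

text \<open>The value \<open>\<langle>action h, h\<rangle> - \<gamma> * mass h\<close> is in the inner sector and \<open>(\<mu> - \<gamma>) * mass h\<close> is outside the outer
  one, so their difference dominates the sum of their moduli.\<close>

lemma coercive:
  assumes out: "outside_sector \<mu>" and h: "h \<in> form_domain"
  shows "a / 10 * (\<kappa> / 2 * energy h + cmod (\<mu> - of_real \<gamma>) * mass h)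
    \<le> cmod (ell2_inner (action h) h - \<mu> * of_real (mass h))"
proof -
  define z where "z = ell2_inner (action h) h - of_real (\<gamma> * mass h)"
  define y where "y = (\<mu> - of_real \<gamma>) * of_real (mass h)"
  have m: "0 \<le> mass h" by (simp add: weighted_sq_nonneg)
  have cy: "cmod y = cmod (\<mu> - of_real \<gamma>) * mass h"
    using m by (simp add: y_def norm_mult)
  have "Re y = Re (\<mu> - of_real \<gamma>) * mass h" by (simp add: y_def)
  also have "\<dots> \<le> (a / 2 * cmod (\<mu> - of_real \<gamma>)) * mass h"
    using out m unfolding outside_sector_def by (intro mult_right_mono)
  finally have "Re y \<le> a / 2 * cmod y" by (simp add: cy)
  then have "(a - a / 2) / 5 * (cmod z + cmod y) \<le> cmod (z - y)"
    using form_in_sector[OF h] a a_le_1 by (intro sector_separation) (auto simp: z_def)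
  moreover have "\<kappa> / 2 * energy h \<le> cmod z"
    using form_bounds_energy[OF h] complex_Re_le_cmod[of z] by (simp add: z_def)
  then have "a / 10 * (\<kappa> / 2 * energy h + cmod y) \<le> a / 10 * (cmod z + cmod y)"
    using a by (intro mult_left_mono) auto
  moreover have "z - y = ell2_inner (action h) h - \<mu> * of_real (mass h)"
    by (simp add: z_def y_def algebra_simps)
  ultimately show ?thesis by (simp add: cy)
qed

text \<open>The same separation for single entries. It makes division by \<open>l - \<mu>\<close> gain a full factor \<open>w\<close>, which is
  exactly what leads from the dual space back to the form domain.\<close>

lemma diagonal_separation:
  assumes out: "outside_sector \<mu>"
  shows "a * \<kappa> / 10 * w j \<le> cmod (l j - \<mu>)"
proof -
  let ?z = "l j - of_real \<gamma>" and ?y = "\<mu> - of_real \<gamma>"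
  have "a * cmod ?z \<le> a * (cmod (l j) + (-\<gamma>))"
    using a \<gamma> norm_triangle_ineq4[of "l j" "of_real \<gamma>"] by (intro mult_left_mono) auto
  also have "\<dots> = a * cmod (l j) + a * (- \<gamma>)" by (simp add: algebra_simps)
  also have "\<dots> \<le> \<kappa> * cmod (l j) + 1 * (- \<gamma>)"
    using a a_le_1 \<gamma> by (intro add_mono mult_right_mono) auto
  also have "\<dots> \<le> Re ?z" using sector[of j] by simp
  finally have "(a - a / 2) / 5 * (cmod ?z + cmod ?y) \<le> cmod (?z - ?y)"
    using out a a_le_1 by (intro sector_separation) (auto simp: outside_sector_def)
  moreover have "\<kappa> * w j \<le> cmod ?z"
    using sector[of j] complex_Re_le_cmod[of ?z] \<gamma> \<kappa> by (simp add: algebra_simps)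
  then have "a / 10 * (\<kappa> * w j) \<le> a / 10 * (cmod ?z + cmod ?y)"
    using a by (intro mult_left_mono) (auto intro: add_increasing2)
  ultimately show ?thesis by simp
qed

lemma diagonal_ne:
  assumes "outside_sector \<mu>" shows "l j - \<mu> \<noteq> 0"
proof -
  have "0 < a * \<kappa> / 10 * w j" using a \<kappa> w_pos[of j] by simp
  then show ?thesis using diagonal_separation[OF assms, of j] by auto
qed

lemma diagonal_resolvent_form_domain:
  assumes out: "outside_sector \<mu>" and p: "p \<in> form_dual"
  shows "(\<lambda>j. p j / (l j - \<mu>)) \<in> form_domain"
proof (rule weighted_ell2_comparison(1)[OF p])
  define c where "c = a * \<kappa> / 10"
  have c: "0 < c" using a \<kappa> by (simp add: c_def)
  show "0 \<le> w j" for j using w_pos[of j] by simp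
  fix j
  have d: "0 < cmod (l j - \<mu>)" using diagonal_ne[OF out, of j] by simp
  have "(c * w j)\<^sup>2 \<le> (cmod (l j - \<mu>))\<^sup>2"
    using diagonal_separation[OF out, of j] c w_pos[of j]
    by (intro power_mono) (auto simp: c_def)
  moreover have "v / s\<^sup>2 \<le> 1 / c\<^sup>2 * (1 / v)" if "(c * v)\<^sup>2 \<le> s\<^sup>2" "0 < v" "0 < s" for v s :: real
    using that c by (simp add: field_simps power2_eq_square)
  ultimately have "w j / (cmod (l j - \<mu>))\<^sup>2 \<le> 1 / c\<^sup>2 * (1 / w j)"
    using d w_pos[of j] by blast
  from mult_right_mono[OF this zero_le_power2[of "cmod (p j)"]]
  show "w j * (cmod (p j / (l j - \<mu>)))\<^sup>2 \<le> 1 / c\<^sup>2 * (1 / w j * (cmod (p j))\<^sup>2)"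
    by (simp add: norm_divide power_divide)
qed

lemma pairing_shifted_action:
  assumes h: "h \<in> form_domain" and k: "k \<in> form_domain"
  shows "ell2_inner (\<lambda>j. action h j - \<mu> * h j) k = ell2_inner (action h) k - \<mu> * ell2_inner h k"
proof -
  have "(\<lambda>j. - \<mu> * h j) \<in> form_dual"
    using h form_domain_subset_form_dual by (intro weighted_ell2_scale) auto
  from pairing_add_left[OF action_form_dual[OF h] this k] show ?thesis
    using ell2_inner_scale_left[of "- \<mu>" h k] by simp
qed

lemma coercive_pairing:
  assumes "outside_sector \<mu>" and h: "h \<in> form_domain"
  shows "a / 10 * (\<kappa> / 2 * energy h + cmod (\<mu> - of_real \<gamma>) * mass h)
    \<le> cmod (ell2_inner (\<lambda>j. action h j - \<mu> * h j) h)"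
  using coercive[OF assms] pairing_shifted_action[OF h h, of \<mu>] form_domain_subset_ell2 h
  by (simp add: ell2_inner_self subset_iff)

lemma shifted_action_injective:
  assumes out: "outside_sector \<mu>" and h: "h \<in> form_domain"
    and ker: "\<And>j. action h j - \<mu> * h j = 0"
  shows "h j = 0"
proof -
  have "ell2_inner (\<lambda>j. action h j - \<mu> * h j) h = 0"
    by (simp add: ker ell2_inner_def)
  with coercive_pairing[OF out h]
  have "a / 10 * (\<kappa> / 2 * energy h + cmod (\<mu> - of_real \<gamma>) * mass h) \<le> 0" by simp
  then have "\<kappa> / 2 * energy h + cmod (\<mu> - of_real \<gamma>) * mass h \<le> 0"
    using a by (simp add: mult_le_0_iff)
  moreover have "0 \<le> cmod (\<mu> - of_real \<gamma>) * mass h" by (simp add: weighted_sq_nonneg)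
  ultimately have "\<kappa> / 2 * energy h \<le> 0" by linarith
  then have "energy h \<le> 0" using \<kappa> by (simp add: mult_le_0_iff)
  then show ?thesis using weighted_sq_eq_0D[of w h j] h w_pos by blast
qed

text \<open>The candidate is \<open>h = (u - c f) / (l - \<mu>)\<close>, which solves the equation as soon as \<open>\<langle>h, g\<rangle> = c\<close>.\<close>

lemma shifted_action_surjective:
  assumes out: "outside_sector \<mu>" and u: "u \<in> form_dual"
  obtains h where "h \<in> form_domain" "\<And>j. action h j - \<mu> * h j = u j"
proof -
  define ru where "ru j = u j / (l j - \<mu>)" for j
  define rf where "rf j = f j / (l j - \<mu>)" for j
  note ne = diagonal_ne[OF out]
  have ru: "ru \<in> form_domain" and rf: "rf \<in> form_domain"
    unfolding ru_def[abs_def] rf_def[abs_def]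
    by (intro diagonal_resolvent_form_domain out u f)+
  \<comment> \<open>Otherwise \<open>rf\<close> would be annihilated, hence zero, and its pairing with \<open>g\<close> would not be \<open>-1\<close>.\<close>
  have nz: "1 + ell2_inner rf g \<noteq> 0"
  proof
    assume 0: "1 + ell2_inner rf g = 0"
    then have i: "ell2_inner rf g = - 1" by (simp add: add_eq_0_iff)
    have "action rf j - \<mu> * rf j = (l j - \<mu>) * rf j - f j" for j
      by (simp add: action_def i algebra_simps)
    then have "action rf j - \<mu> * rf j = 0" for j
      using ne[of j] by (simp add: rf_def)
    from shifted_action_injective[OF out rf this] have "rf = (\<lambda>_. 0)" by auto
    then have "ell2_inner rf g = 0" by (simp add: ell2_inner_def)
    with i show False by simp
  qed
  define c where "c = ell2_inner ru g / (1 + ell2_inner rf g)"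
  have c: "ell2_inner ru g = c + c * ell2_inner rf g"
  proof -
    have "c * (1 + ell2_inner rf g) = ell2_inner ru g" using nz by (simp add: c_def)
    then show ?thesis by (simp add: distrib_left)
  qed
  define h where "h j = ru j + - c * rf j" for j
  have crf: "(\<lambda>j. - c * rf j) \<in> form_domain" by (rule weighted_ell2_scale[OF rf])
  have h: "h \<in> form_domain"
    unfolding h_def[abs_def] by (rule form_domain_add[OF ru crf])
  have "ell2_inner h g = ell2_inner ru g + ell2_inner (\<lambda>j. - c * rf j) g"
    unfolding h_def[abs_def] using ru crf g by (intro ell2_inner_add_left pairing_swapped)
  also have "\<dots> = c"
    unfolding ell2_inner_scale_left using c by simp
  finally have hg: "ell2_inner h g = c" .
  have "action h j - \<mu> * h j = u j" for j
  proof -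
    have "(l j - \<mu>) * ru j = u j" "(l j - \<mu>) * rf j = f j"
      using ne[of j] by (simp_all add: ru_def rf_def)
    moreover have "action h j - \<mu> * h j = (l j - \<mu>) * ru j - c * ((l j - \<mu>) * rf j) + c * f j"
      by (simp add: action_def hg h_def algebra_simps)
    ultimately show ?thesis by simp
  qed
  with h show ?thesis by (rule that)
qed

lemma resolvent_estimate:
  assumes out: "outside_sector \<mu>" and h: "h \<in> form_domain"
    and u: "(\<lambda>j. action h j - \<mu> * h j) \<in> ell2"
  shows "a / 10 * cmod (\<mu> - of_real \<gamma>) * ell2_norm h \<le> ell2_norm (\<lambda>j. action h j - \<mu> * h j)"
proof (cases "ell2_norm h = 0")
  case True
  then show ?thesis by (simp add: ell2_norm_nonneg)
next
  case False
  then have pos: "0 < ell2_norm h" using ell2_norm_nonneg[of h] by simp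
  have "0 \<le> \<kappa> / 2 * energy h" using \<kappa> by (simp add: weighted_sq_nonneg w_pos less_imp_le)
  then have "a / 10 * (cmod (\<mu> - of_real \<gamma>) * mass h)
      \<le> a / 10 * (\<kappa> / 2 * energy h + cmod (\<mu> - of_real \<gamma>) * mass h)"
    using a by (intro mult_left_mono) auto
  also have "\<dots> \<le> cmod (ell2_inner (\<lambda>j. action h j - \<mu> * h j) h)"
    by (rule coercive_pairing[OF out h])
  also have "\<dots> \<le> ell2_norm (\<lambda>j. action h j - \<mu> * h j) * ell2_norm h"
    using h form_domain_subset_ell2 by (intro ell2_Cauchy_Schwarz u) auto
  finally have "(a / 10 * cmod (\<mu> - of_real \<gamma>) * ell2_norm h) * ell2_norm h
      \<le> ell2_norm (\<lambda>j. action h j - \<mu> * h j) * ell2_norm h"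
    by (simp add: power2_eq_square mult.assoc flip: ell2_norm_sq)
  then show ?thesis using pos by simp
qed


section \<open>The operator of the form\<close>

lemma zero_form_domain: "(\<lambda>_. 0) \<in> form_domain"
  by (rule weighted_ell2_finite_support[of "{}"]) auto

lemma action_zero: "action (\<lambda>_. 0) = (\<lambda>_. 0)"
  using action_scale[of 0 "\<lambda>_. 0"] by simp

text \<open>The part of the action in \<open>\<ell>\<^sup>2\<close>; this is the operator associated with the form.\<close>

definition form_operator :: "'j operator" where
  "form_operator = {(h, action h) | h. h \<in> form_domain \<and> action h \<in> ell2}"

lemma Domain_form_operator: "Domain form_operator = {h \<in> form_domain. action h \<in> ell2}"
  by (auto simp: form_operator_def)

lemma linear_form_operator: "linear_operator form_operator"
  unfolding linear_operator_def linear_submanifold_def Domain_form_operator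
proof (intro conjI allI ballI impI)
  show "form_operator \<subseteq> ell2 \<times> ell2" "single_valued form_operator"
    using form_domain_subset_ell2 by (auto simp: form_operator_def single_valued_def)
qed (use form_domain_subset_ell2 in \<open>auto simp: form_operator_def action_add action_scale action_zero
    ell2_zero ell2_add ell2_scale zero_form_domain form_domain_add weighted_ell2_scale\<close>)

text \<open>Finitely supported families \<open>u\<close> are dense, so it suffices to approximate these. Let \<open>k\<close> solve
  \<open>(A - \<mu>) k = \<nu> u\<close> with \<open>\<mu> = \<gamma> - \<nu>\<close>. Then \<open>d = k - u\<close> satisfies \<open>(A - \<mu>) d = - \<phi>\<close>, where
  \<open>\<phi> = A u - \<gamma> u\<close> is a dual family that does not depend on \<open>\<nu>\<close>. Coercivity bounds
  \<open>\<kappa> / 2 * energy d + \<nu> * mass d\<close> by a multiple of \<open>\<surd>(energy d)\<close>. The energy is absorbed, and \<open>\<nu> * mass d\<close>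
  stays bounded.\<close>

lemma densely_defined_form_operator: "densely_defined form_operator"
  unfolding densely_defined_def
proof (intro ballI allI impI)
  fix h :: "'j \<Rightarrow> complex" and e :: real assume h: "h \<in> ell2" and e: "0 < e"
  have "h \<in> weighted_ell2 (\<lambda>_. 1)" using h by (simp add: ell2_eq_weighted_ell2)
  from weighted_sq_tail[OF this, of "e\<^sup>2 / 8"] e obtain F where F: "finite F"
    and tail: "mass (\<lambda>j. if j \<in> F then 0 else h j) \<le> e\<^sup>2 / 8" by auto
  define u where "u j = (if j \<in> F then h j else 0)" for j
  have u: "u \<in> form_domain" by (rule weighted_ell2_finite_support[OF F]) (simp add: u_def)
  define \<phi> where "\<phi> j = action u j - of_real \<gamma> * u j" for j
  have "(\<lambda>j. - of_real \<gamma> * u j) \<in> form_dual"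
    using u form_domain_subset_form_dual by (intro weighted_ell2_scale) auto
  from weighted_ell2_add(1)[OF form_dual_nonneg action_form_dual[OF u] this]
  have \<phi>: "\<phi> \<in> form_dual" by (simp add: \<phi>_def[abs_def])
  define P where "P = sqrt (weighted_sq (\<lambda>j. 1 / w j) \<phi>)"
  define \<delta> where "\<delta> = a * \<kappa> / 20"
  have \<delta>: "0 < \<delta>" using a \<kappa> by (simp add: \<delta>_def)
  \<comment> \<open>\<open>K\<close> is the bound for \<open>\<nu> * mass d\<close>; \<open>\<nu>\<close> is chosen to make \<open>mass d < e\<^sup>2 / 8\<close>.\<close>
  define K where "K = P\<^sup>2 / (4 * \<delta>) / (a / 10)"
  define \<nu> where "\<nu> = 8 * K / e\<^sup>2 + 1"
  have K: "0 \<le> K" using \<delta> a by (simp add: K_def)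
  then have \<nu>: "0 < \<nu>" using e by (simp add: \<nu>_def add_nonneg_pos)
  define \<mu> where "\<mu> = complex_of_real (\<gamma> - \<nu>)"
  have \<mu>\<gamma>: "\<mu> - of_real \<gamma> = of_real (- \<nu>)" by (simp add: \<mu>_def)
  have out: "outside_sector \<mu>"
    unfolding outside_sector_def \<mu>\<gamma> using \<nu> mult_pos_pos[OF a(1) \<nu>] by simp
  have "(\<lambda>j. of_real \<nu> * u j) \<in> form_dual"
    using u form_domain_subset_form_dual by (intro weighted_ell2_scale) auto
  from shifted_action_surjective[OF out this] obtain k where k: "k \<in> form_domain"
    and keq: "\<And>j. action k j - \<mu> * k j = of_real \<nu> * u j" by blast
  have "action k = (\<lambda>j. of_real \<nu> * u j + \<mu> * k j)"
    using keq by (auto simp: algebra_simps)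
  moreover have "k \<in> ell2" "u \<in> ell2" using k u form_domain_subset_ell2 by auto
  ultimately have kD: "k \<in> Domain form_operator"
    using k by (simp add: Domain_form_operator ell2_add ell2_scale)
  define d where "d j = k j + - 1 * u j" for j
  have mu: "(\<lambda>j. - 1 * u j) \<in> form_domain" by (rule weighted_ell2_scale[OF u])
  have d: "d \<in> form_domain" unfolding d_def[abs_def] by (rule form_domain_add[OF k mu])
  have "action d = (\<lambda>j. action k j + - 1 * action u j)"
    unfolding d_def[abs_def] action_add[OF k mu] action_scale ..
  then have "action d j - \<mu> * d j = (action k j - \<mu> * k j) - (action u j - \<mu> * u j)" for j
    by (simp add: d_def algebra_simps)
  then have "action d j - \<mu> * d j = - 1 * \<phi> j" for j
    unfolding keq by (simp add: \<phi>_def \<mu>_def algebra_simps)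
  then have "ell2_inner (\<lambda>j. action d j - \<mu> * d j) d = - 1 * ell2_inner \<phi> d"
    using ell2_inner_scale_left[of "-1" \<phi> d] by presburger
  then have "a / 10 * (\<kappa> / 2 * energy d + \<nu> * mass d) \<le> cmod (ell2_inner \<phi> d)"
    using coercive_pairing[OF out d] \<nu> unfolding \<mu>\<gamma> by simp
  also have "\<dots> \<le> P * sqrt (energy d)"
    unfolding P_def by (rule pairing(2)[OF \<phi> d])
  \<comment> \<open>By \<open>P * x \<le> \<delta> * x\<^sup>2 + P\<^sup>2 / (4 * \<delta>)\<close>, where \<open>\<delta>\<close> is the coefficient of the energy on the left.\<close>
  also have "\<dots> \<le> \<delta> * energy d + P\<^sup>2 / (4 * \<delta>)"
  proof -
    have en: "(sqrt (energy d))\<^sup>2 = energy d"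
      by (simp add: weighted_sq_nonneg w_pos less_imp_le)
    have "0 \<le> (2 * \<delta> * sqrt (energy d) - P)\<^sup>2" by simp
    then have "4 * \<delta> * (P * sqrt (energy d)) \<le> 4 * \<delta> * (\<delta> * energy d) + P\<^sup>2"
      by (simp add: power2_diff power_mult_distrib en) (simp add: power2_eq_square algebra_simps)
    then show ?thesis using \<delta> by (simp add: field_simps)
  qed
  finally have "a / 10 * (\<nu> * mass d) \<le> P\<^sup>2 / (4 * \<delta>)"
    by (simp add: \<delta>_def algebra_simps)
  then have "\<nu> * mass d \<le> K" unfolding K_def using a by (subst pos_le_divide_eq) (auto simp: mult_ac)
  moreover have "8 * K / e\<^sup>2 * mass d \<le> \<nu> * mass d"
    by (intro mult_right_mono) (auto simp: \<nu>_def weighted_sq_nonneg)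
  ultimately have *: "\<nu> * mass d \<le> K" by simp
  have "K < \<nu> * (e\<^sup>2 / 8)" using e by (simp add: \<nu>_def field_simps)
  with * have "\<nu> * mass d < \<nu> * (e\<^sup>2 / 8)" by linarith
  then have md: "mass d < e\<^sup>2 / 8" using \<nu> by simp
  have "mass (\<lambda>j. (if j \<in> F then 0 else h j) + - d j)
      \<le> 2 * mass (\<lambda>j. if j \<in> F then 0 else h j) + 2 * mass (\<lambda>j. - d j)"
  proof (rule weighted_ell2_add(2))
    have "(\<lambda>j. h j - u j) \<in> ell2" using h \<open>u \<in> ell2\<close> by (rule ell2_diff)
    moreover have "(\<lambda>j. h j - u j) = (\<lambda>j. if j \<in> F then 0 else h j)" by (auto simp: u_def)
    ultimately show "(\<lambda>j. if j \<in> F then 0 else h j) \<in> weighted_ell2 (\<lambda>_. 1)"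
      by (simp add: ell2_eq_weighted_ell2)
    show "(\<lambda>j. - d j) \<in> weighted_ell2 (\<lambda>_. 1)"
      using d form_domain_subset_ell2 weighted_ell2_scale[of d "\<lambda>_. 1" "-1"]
      by (auto simp: ell2_eq_weighted_ell2)
  qed simp
  also have "\<dots> < e\<^sup>2"
    using tail md e zero_less_power[of e 2] unfolding weighted_sq_uminus by linarith
  also have "(\<lambda>j. (if j \<in> F then 0 else h j) + - d j) = (\<lambda>j. h j - k j)"
    by (auto simp: d_def u_def)
  finally have "ell2_norm (\<lambda>j. h j - k j) < e"
    using e by (simp add: ell2_norm_eq_weighted_sq real_less_lsqrt weighted_sq_nonneg real_sqrt_less_iff)
  with kD show "\<exists>k\<in>Domain form_operator. ell2_norm (\<lambda>j. h j - k j) < e" by blast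
qed

text \<open>Injectivity, surjectivity and the norm bound of the resolvent are those of the action; an \<open>\<ell>\<^sup>2\<close> right-hand
  side forces \<open>action h = u + \<mu> h\<close> to be in \<open>\<ell>\<^sup>2\<close>.\<close>

lemma bounded_resolvent_form_operator:
  assumes out: "outside_sector \<mu>" and ne: "\<mu> \<noteq> of_real \<gamma>"
  shows "\<mu> \<in> resolvent_set form_operator"
    and "op_norm (resolvent form_operator \<mu>) \<le> 10 / a / cmod (\<mu> - of_real \<gamma>)"
proof -
  let ?R = "resolvent form_operator \<mu>" and ?c = "10 / a / cmod (\<mu> - of_real \<gamma>)"
  have R: "(u, h) \<in> ?R \<longleftrightarrow>
      h \<in> form_domain \<and> action h \<in> ell2 \<and> u = (\<lambda>j. action h j - \<mu> * h j)" for u h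
    by (auto simp: resolvent_def form_operator_def)
  have ell2: "h \<in> ell2" "u \<in> ell2" if "(u, h) \<in> ?R" for u h
    using that form_domain_subset_ell2 by (auto simp: R intro!: ell2_diff ell2_scale)
  have c: "0 < ?c" using a ne by simp
  have est: "ell2_norm h \<le> ?c * ell2_norm u" if "(u, h) \<in> ?R" for u h
    using resolvent_estimate[OF out, of h] that ell2(2)[OF that] a ne
    by (auto simp: R field_simps)
  have lin: "(\<lambda>j. u j + v j, \<lambda>j. h j + k j) \<in> ?R" if "(u, h) \<in> ?R" "(v, k) \<in> ?R" for u h v k
    using that by (auto simp: R action_add form_domain_add ell2_add algebra_simps)
  have scale: "(\<lambda>j. c * u j, \<lambda>j. c * h j) \<in> ?R" if "(u, h) \<in> ?R" for c u h
    using that by (auto simp: R action_scale weighted_ell2_scale ell2_scale algebra_simps)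
  have dom: "Domain ?R = ell2"
  proof (intro equalityI subsetI)
    fix u :: "'j \<Rightarrow> complex" assume u: "u \<in> ell2"
    then have "u \<in> form_dual" using ell2_subset_form_dual by auto
    from shifted_action_surjective[OF out this] obtain h where h: "h \<in> form_domain"
      and eq: "\<And>j. action h j - \<mu> * h j = u j" by blast
    have "action h = (\<lambda>j. u j + \<mu> * h j)" using eq by (auto simp: algebra_simps)
    then have "action h \<in> ell2"
      using u h form_domain_subset_ell2 by (auto intro!: ell2_add ell2_scale)
    then have "(u, h) \<in> ?R" using h eq by (auto simp: R)
    then show "u \<in> Domain ?R" by blast
  qed (use ell2 in auto)
  have sv: "single_valued ?R"
  proof (rule single_valuedI)
    fix u h k assume "(u, h) \<in> ?R" "(u, k) \<in> ?R"
    from lin[OF this(1) scale[OF this(2), of "-1"]]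
    have D: "((\<lambda>_. 0), (\<lambda>j. h j - k j)) \<in> ?R" by simp
    from est[OF D] have "ell2_norm (\<lambda>j. h j - k j) = 0"
      using ell2_norm_nonneg[of "\<lambda>j. h j - k j"] by (simp add: ell2_norm_zero)
    from ell2_norm_eq_0D[OF ell2(1)[OF D] this] show "h = k" by auto
  qed
  have "linear_operator ?R"
    unfolding linear_operator_def dom using ell2 sv lin scale
    by (auto simp: linear_submanifold_def ell2_zero ell2_add ell2_scale)
  then show "\<mu> \<in> resolvent_set form_operator"
    unfolding resolvent_set_def bounded_operator_def using dom est by blast
  show "op_norm ?R \<le> ?c"
    unfolding op_norm_def
  proof (rule cSup_least)
    have "((\<lambda>_. 0), (\<lambda>_. 0)) \<in> ?R" by (simp add: R action_zero zero_form_domain ell2_zero)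
    then have "ell2_norm (\<lambda>_. 0) \<in> {ell2_norm h |u h. (u, h) \<in> ?R \<and> ell2_norm u \<le> 1}"
      unfolding mem_Collect_eq by (intro exI[of _ "\<lambda>_. 0"] conjI refl) (simp_all add: ell2_norm_zero)
    then show "{ell2_norm h |u h. (u, h) \<in> ?R \<and> ell2_norm u \<le> 1} \<noteq> {}" by blast
    fix x assume "x \<in> {ell2_norm h |u h. (u, h) \<in> ?R \<and> ell2_norm u \<le> 1}"
    then obtain u h where "(u, h) \<in> ?R" "ell2_norm u \<le> 1" "x = ell2_norm h" by auto
    with est[of u h] mult_left_mono[of "ell2_norm u" 1 ?c] c show "x \<le> ?c" by auto
  qed
qed

lemma sectorial_form_operator: "sectorial form_operator"
  unfolding sectorial_def sectorial_with_def
proof (intro exI conjI allI impI)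
  show "linear_operator form_operator" by (rule linear_form_operator)
  show "densely_defined form_operator" by (rule densely_defined_form_operator)
  have "arccos 1 < arccos (a / 2)" "arccos (a / 2) < arccos 0"
    using a a_le_1 by (intro arccos_less_arccos; simp)+
  then show th: "0 < arccos (a / 2)" "arccos (a / 2) < pi / 2" by simp_all
  show "0 < 10 / a" using a by simp
  fix \<mu> assume arg: "arccos (a / 2) \<le> \<bar>Arg (\<mu> - of_real \<gamma>)\<bar>"
  then have "\<mu> \<noteq> of_real \<gamma>" using th by (auto simp: Arg_zero)
  moreover have "outside_sector \<mu>"
    using sector_complement_cosD[OF arg] th a a_le_1 by (simp add: outside_sector_def)
  ultimately show "\<mu> \<in> resolvent_set form_operator"
    "op_norm (resolvent form_operator \<mu>) \<le> 10 / a / cmod (\<mu> - of_real \<gamma>)"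
    using bounded_resolvent_form_operator by auto
qed

text \<open>Unit vectors belong to the form domain and determine a family entrywise, so \<open>T\<close> is a restriction of
  the form operator. Equality follows because at a point \<open>x\<close> to the left of both vertices \<open>T - x\<close> is
  surjective and the action minus \<open>x\<close> is injective.\<close>

lemma form_operator_unique:
  assumes T: "sectorial T" "Domain T \<subseteq> form_domain"
    and rep: "\<And>h k. h \<in> Domain T \<Longrightarrow> k \<in> form_domain \<Longrightarrow>
      ell2_inner (action h) k = ell2_inner (op_apply T h) k"
  shows "T = form_operator"
proof -
  from T(1) obtain t \<alpha> M where lin: "linear_operator T" and t: "t < pi / 2"
    and res: "\<And>\<mu>. t \<le> \<bar>Arg (\<mu> - complex_of_real \<alpha>)\<bar> \<Longrightarrow> \<mu> \<in> resolvent_set T"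
    unfolding sectorial_def sectorial_with_def by blast
  have TE: "h \<in> form_domain \<and> action h = u \<and> u \<in> ell2" if "(h, u) \<in> T" for h u
  proof -
    have "op_apply T h = u"
      unfolding op_apply_def using that lin
      by (intro the_equality) (auto simp: linear_operator_def single_valued_def)
    moreover have "action h j = op_apply T h j" for j
    proof -
      have "(\<lambda>i. if i = j then 1 else 0) \<in> form_domain"
        by (rule weighted_ell2_finite_support[of "{j}"]) auto
      from rep[OF _ this, of h] that show ?thesis by (auto simp: ell2_inner_unit)
    qed
    ultimately have "action h = u" by auto
    then show ?thesis using that T(2) lin by (auto simp: linear_operator_def)
  qed
  then have sub: "T \<subseteq> form_operator" by (auto simp: form_operator_def)
  define x where "x = min \<gamma> \<alpha> - 1"
  have "Arg (of_real (x - \<alpha>)) = pi" by (rule Arg_of_real[THEN trans]) (simp add: x_def)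
  moreover have "t \<le> pi" using t pi_gt_zero by linarith
  ultimately have "of_real x \<in> resolvent_set T" by (intro res) simp
  then have surj: "Domain (resolvent T (of_real x)) = ell2"
    by (simp add: resolvent_set_def bounded_operator_def)
  have out: "outside_sector (of_real x)"
    using a by (simp add: outside_sector_def x_def order.trans[of _ 0] flip: of_real_diff)
  have "form_operator \<subseteq> T"
  proof (rule subrelI)
    fix h u assume hu: "(h, u) \<in> form_operator"
    then have h: "h \<in> form_domain" and u: "u = action h" "u \<in> ell2" by (auto simp: form_operator_def)
    have "(\<lambda>j. u j - of_real x * h j) \<in> ell2"
      using u h form_domain_subset_ell2 by (auto intro!: ell2_diff ell2_scale)
    then obtain k where "((\<lambda>j. u j - of_real x * h j), k) \<in> resolvent T (of_real x)"
      using surj by blast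
    then obtain v where kv: "(k, v) \<in> T"
      and eq: "(\<lambda>j. u j - of_real x * h j) = (\<lambda>j. v j - of_real x * k j)"
      unfolding resolvent_def by blast
    from TE[OF kv] have k: "k \<in> form_domain" "v = action k" by auto
    have mk: "(\<lambda>j. - 1 * k j) \<in> form_domain" by (rule weighted_ell2_scale[OF k(1)])
    have "action (\<lambda>j. h j + - 1 * k j) = (\<lambda>j. action h j + - 1 * action k j)"
      unfolding action_add[OF h mk] action_scale ..
    then have "action (\<lambda>j. h j + - 1 * k j) j - of_real x * (h j + - 1 * k j) = 0" for j
      using fun_cong[OF eq, of j] by (simp add: u(1) k(2) algebra_simps)
    from shifted_action_injective[OF out form_domain_add[OF h mk] this]
    have "h j = k j" for j by simp
    then have "h = k" by auto
    then show "(h, u) \<in> T" using kv u k by simp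
  qed
  with sub show ?thesis by blast
qed

end


section \<open>Sectorial diagonal operators and their square roots\<close>

text \<open>An entry outside the open sector would belong to the resolvent set, although at an entry \<open>l j\<close> the
  \<open>j\<close>-th unit vector is not in the range of the shifted diagonal operator.\<close>

lemma sectorial_diag_op_entries:
  assumes "sectorial_with \<theta> 0 (diag_op l)"
  shows "\<bar>Arg (l j)\<bar> < \<theta>"
proof (rule ccontr)
  assume "\<not> \<bar>Arg (l j)\<bar> < \<theta>"
  then have "l j \<in> resolvent_set (diag_op l)"
    using assms by (auto simp: sectorial_with_def)
  then have "Domain (resolvent (diag_op l) (l j)) = ell2"
    by (simp add: resolvent_set_def bounded_operator_def)
  moreover have "(\<lambda>i. if i = j then 1 else 0) \<in> ell2"
    by (rule finite_support_ell2[of "{j}"]) auto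
  ultimately obtain h where "(\<lambda>i. if i = j then 1 else 0) = (\<lambda>i. l i * h i - l j * h i)"
    unfolding resolvent_def diag_op_def by blast
  from fun_cong[OF this, of j] show False by simp
qed

lemma cmod_csqrt_sq: "(cmod (csqrt z))\<^sup>2 = cmod z"
  by (metis norm_power power2_csqrt)

lemma Domain_R_op: "Domain (R_op l) = weighted_ell2 (\<lambda>j. 1 + cmod (l j))"
proof -
  have "h \<in> weighted_ell2 (\<lambda>j. 1 + cmod (l j))" if "h \<in> ell2" "(\<lambda>j. csqrt (l j) * h j) \<in> ell2" for h
  proof -
    have "(\<lambda>j. (cmod (h j))\<^sup>2 + (cmod (csqrt (l j) * h j))\<^sup>2) summable_on UNIV"
      using that by (intro summable_on_add) (auto simp: ell2_def)
    then show ?thesis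
      by (simp add: weighted_ell2_def norm_mult power_mult_distrib cmod_csqrt_sq algebra_simps)
  qed
  moreover have "h \<in> ell2" "(\<lambda>j. csqrt (l j) * h j) \<in> ell2"
    if h: "h \<in> weighted_ell2 (\<lambda>j. 1 + cmod (l j))" for h
    unfolding ell2_eq_weighted_ell2
    using weighted_ell2_comparison(1)[OF h, of "\<lambda>_. 1" _ 1]
    by (auto simp: norm_mult power_mult_distrib cmod_csqrt_sq algebra_simps)
  moreover have "Domain (R_op l) = {h. h \<in> ell2 \<and> (\<lambda>j. csqrt (l j) * h j) \<in> ell2}"
    unfolding R_op_def diag_op_def by blast
  ultimately show ?thesis by blast
qed

lemma Q_R_eq:
  assumes h: "h \<in> Domain (R_op l)" and k: "k \<in> Domain (R_op l)"
  shows "Q_R l h k = ell2_inner (\<lambda>j. l j * h j) k"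
proof -
  have apply_diag: "op_apply (diag_op d) h = (\<lambda>j. d j * h j)"
    if "h \<in> ell2" "(\<lambda>j. d j * h j) \<in> ell2" for d h :: "'a \<Rightarrow> complex"
    unfolding op_apply_def by (rule the_equality) (use that in \<open>auto simp: diag_op_def\<close>)
  have h': "h \<in> ell2" "(\<lambda>j. csqrt (l j) * h j) \<in> ell2"
    and k': "k \<in> ell2" "(\<lambda>j. csqrt (l j) * k j) \<in> ell2"
    using h k by (auto simp: R_op_def diag_op_def)
  have "(\<lambda>j. cnj (csqrt (l j)) * k j) \<in> ell2"
    using k'(2) by (simp add: ell2_def norm_mult)
  then have "Q_R l h k = (\<Sum>\<^sub>\<infinity>j. csqrt (l j) * h j * cnj (cnj (csqrt (l j)) * k j))"
    unfolding Q_R_def R_op_def adjoint_diag_op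
    by (simp add: apply_diag h' k' ell2_inner_def)
  moreover have "csqrt (l j) * h j * cnj (cnj (csqrt (l j)) * k j) = l j * h j * cnj (k j)" for j
  proof -
    have "csqrt (l j) * h j * cnj (cnj (csqrt (l j)) * k j) = (csqrt (l j))\<^sup>2 * h j * cnj (k j)"
      by (simp only: power2_eq_square complex_cnj_mult complex_cnj_cnj mult_ac)
    then show ?thesis by simp
  qed
  ultimately show ?thesis by (simp only: ell2_inner_def)
qed

text \<open>Principal square roots have nonnegative real part and \<open>z0\<close> is negative, so the denominators do not
  vanish; and \<open>\<bar>\<surd>l - z0\<bar>\<^sup>2 \<le> 2 * \<bar>l\<bar> + 2 * z0\<^sup>2\<close> is at most a multiple of the weight \<open>1 + \<bar>l\<bar>\<close>.\<close>

lemma form_dual_of_root_weight: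
  assumes "z0 < 0"
    and "(\<lambda>j. (cmod (p j))\<^sup>2 / (cmod (csqrt (l j) - complex_of_real z0))\<^sup>2) summable_on UNIV"
  shows "p \<in> weighted_ell2 (\<lambda>j. 1 / (1 + cmod (l j)))"
proof (rule weighted_ell2_comparison(1))
  let ?d = "\<lambda>j. (cmod (csqrt (l j) - complex_of_real z0))\<^sup>2"
  show "p \<in> weighted_ell2 (\<lambda>j. 1 / ?d j)"
    using assms(2) by (simp add: weighted_ell2_def)
  show "0 \<le> 1 / (1 + cmod (l j))" for j by simp
  fix j
  have "0 < Re (csqrt (l j) - complex_of_real z0)"
    using Re_csqrt[of "l j"] \<open>z0 < 0\<close> by (simp only: minus_complex.sel Re_complex_of_real)
  then have "csqrt (l j) - complex_of_real z0 \<noteq> 0" by (metis less_irrefl zero_complex.sel(1))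
  then have d: "0 < ?d j" by (simp del: csqrt.sel)
  have "?d j \<le> 2 * cmod (l j) + 2 * z0\<^sup>2"
    using norm_add_sq_le[of "csqrt (l j)" "- complex_of_real z0"] by (simp add: cmod_csqrt_sq)
  also have "\<dots> \<le> (2 + 2 * z0\<^sup>2) * (1 + cmod (l j))"
    by (simp add: algebra_simps)
  finally have le: "?d j \<le> (2 + 2 * z0\<^sup>2) * (1 + cmod (l j))" .
  have "1 / v \<le> c * (1 / e)" if "e \<le> c * v" "0 < v" "0 < e" for v c e :: real
    using that by (simp add: field_simps)
  from this[OF le _ d] have "1 / (1 + cmod (l j)) \<le> (2 + 2 * z0\<^sup>2) * (1 / ?d j)"
    by (simp add: add_pos_nonneg)
  from mult_right_mono[OF this zero_le_power2[of "cmod (p j)"]]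
  show "1 / (1 + cmod (l j)) * (cmod (p j))\<^sup>2 \<le> (2 + 2 * z0\<^sup>2) * (1 / ?d j * (cmod (p j))\<^sup>2)"
    by (simp add: mult.assoc)
qed

lemma sectorial_form_cong:
  assumes Q: "sectorial_form D Q" and eq: "\<And>h k. h \<in> D \<Longrightarrow> k \<in> D \<Longrightarrow> Q' h k = Q h k"
  shows "sectorial_form D Q'"
proof -
  have D: "linear_submanifold D" using Q by (simp add: sectorial_form_def sesquilinear_form_def)
  have add: "(\<lambda>j. h j + k j) \<in> D" if "h \<in> D" "k \<in> D" for h k
    using D that by (simp add: linear_submanifold_def)
  have scale: "(\<lambda>j. c * h j) \<in> D" if "h \<in> D" for c h
    using D that by (simp add: linear_submanifold_def)
  show ?thesis
    using Q unfolding sectorial_form_def sesquilinear_form_def by (simp add: eq add scale)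
qed

theorem theorem7p6:
  fixes l f g :: "'j::{countable, preorder} \<Rightarrow> complex" and \<theta> z0 :: real
  assumes "infinite (UNIV :: 'j set)"
    and "\<And>i j :: 'j. \<exists>m. i \<le> m \<and> j \<le> m"
    and "sectorial_with \<theta> 0 (diag_op l)"
    and "z0 < 0"
    and "(\<lambda>j. (cmod (g j))\<^sup>2 / (cmod (csqrt (l j) - complex_of_real z0))\<^sup>2) summable_on UNIV"
    and "(\<lambda>j. (cmod (f j))\<^sup>2 / (cmod (csqrt (l j) - complex_of_real z0))\<^sup>2) summable_on UNIV"
  shows "(\<forall>h \<in> Domain (R_op l). \<forall>k \<in> Domain (R_op l). Q_fg_defined f g h k) \<and>
    sectorial_form (Domain (R_op l)) (\<lambda>h k. Q_R l h k + Q_fg f g h k) \<and>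
    (\<exists>!T. sectorial T \<and> Domain T \<subseteq> Domain (R_op l) \<and>
       (\<forall>h \<in> Domain T. \<forall>k \<in> Domain (R_op l).
          Q_R l h k + Q_fg f g h k = ell2_inner (op_apply T h) k))"
proof -
  have \<theta>: "0 < \<theta>" "\<theta> < pi / 2" using assms(3) by (auto simp: sectorial_with_def)
  interpret perturbed_diagonal l f g "cos \<theta>"
  proof
    show "0 < cos \<theta>" using \<theta> by (intro cos_gt_zero) auto
    show "cos \<theta> \<le> 1" by simp
    show "cos \<theta> * cmod (l j) \<le> Re (l j)" for j
      using sectorial_diag_op_entries[OF assms(3), of j] \<theta> by (intro sector_cosD) auto
  qed (rule form_dual_of_root_weight[OF assms(4)], rule assms)+
  obtain \<gamma> a where "coercive_perturbed_diagonal l f g (cos \<theta>) \<gamma> a"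
  proof (rule form_sector_bound)
    fix \<gamma> a :: real
    assume "\<gamma> \<le> -1" "0 < a" "a \<le> cos \<theta>"
      "\<And>h. h \<in> form_domain \<Longrightarrow>
         a * cmod (ell2_inner (action h) h - of_real (\<gamma> * mass h))
           \<le> Re (ell2_inner (action h) h - of_real (\<gamma> * mass h))"
      "\<And>h. h \<in> form_domain \<Longrightarrow>
         cos \<theta> / 2 * energy h \<le> Re (ell2_inner (action h) h - of_real (\<gamma> * mass h))"
    then have "coercive_perturbed_diagonal l f g (cos \<theta>) \<gamma> a" by unfold_locales
    then show ?thesis by (rule that)
  qed
  then interpret coercive_perturbed_diagonal l f g "cos \<theta>" \<gamma> a .
  have form: "Q_R l h k + Q_fg f g h k = ell2_inner (action h) k"
    if "h \<in> form_domain" "k \<in> form_domain" for h k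
  proof -
    have "Q_R l h k = ell2_inner (\<lambda>j. l j * h j) k"
      using that by (intro Q_R_eq) (simp_all only: Domain_R_op)
    moreover have "Q_fg f g h k = ell2_inner h g * ell2_inner f k"
      by (simp only: Q_fg_def ell2_inner_def)
    ultimately show ?thesis by (simp only: pairing_action[OF that])
  qed
  show ?thesis
    unfolding Domain_R_op
  proof (intro conjI ballI)
    show "Q_fg_defined f g h k" if "h \<in> form_domain" "k \<in> form_domain" for h k
      using pairing_swapped[OF that(1) g] pairing(1)[OF f that(2)]
      by (simp add: Q_fg_defined_def)
    show "sectorial_form form_domain (\<lambda>h k. Q_R l h k + Q_fg f g h k)"
      using form by (rule sectorial_form_cong[OF sectorial_action_form])
    show "\<exists>!T. sectorial T \<and> Domain T \<subseteq> form_domain \<and>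
       (\<forall>h \<in> Domain T. \<forall>k \<in> form_domain.
          Q_R l h k + Q_fg f g h k = ell2_inner (op_apply T h) k)"
    proof (rule ex1I)
      have "op_apply form_operator h = action h" if "h \<in> Domain form_operator" for h
        unfolding op_apply_def
        by (rule the_equality) (use that in \<open>auto simp: form_operator_def\<close>)
      then show "sectorial form_operator \<and> Domain form_operator \<subseteq> form_domain \<and>
        (\<forall>h \<in> Domain form_operator. \<forall>k \<in> form_domain.
          Q_R l h k + Q_fg f g h k = ell2_inner (op_apply form_operator h) k)"
        using sectorial_form_operator form by (simp add: Domain_form_operator subset_iff)
    next
      fix T assume T: "sectorial T \<and> Domain T \<subseteq> form_domain \<and>
        (\<forall>h \<in> Domain T. \<forall>k \<in> form_domain.
          Q_R l h k + Q_fg f g h k = ell2_inner (op_apply T h) k)"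
      have dom: "Domain T \<subseteq> form_domain" by (rule conjunct1[OF conjunct2[OF T]])
      show "T = form_operator"
      proof (rule form_operator_unique)
        show "sectorial T" by (rule conjunct1[OF T])
        fix h k assume h: "h \<in> Domain T" and k: "k \<in> form_domain"
        have "Q_R l h k + Q_fg f g h k = ell2_inner (op_apply T h) k"
          by (rule bspec[OF bspec[OF conjunct2[OF conjunct2[OF T]] h] k])
        then show "ell2_inner (action h) k = ell2_inner (op_apply T h) k"
          using form[OF subsetD[OF dom h] k] by simp
      qed (rule dom)
    qed
  qed
qed

end
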